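(* Let $x_0\in\mathcal{X}$. Assume: (i) (Assumption 2) $\inf_{(x,u)\in\mathbb{K},\,r\in\mathscr{R}_c} f^{\gamma}(r\mid x,u)>0$ and $\inf_{(x,u)\in\mathbb{K},\,y\in\mathcal{X}} q^{\gamma}(y\mid x,u)>0$ for every $\gamma\in\mathcal{P}$, and $\inf_{(x,u)\in\mathbb{K}}\mathcal{K}(\rho^{\theta}_{x,u}\mid\rho^{\gamma}_{x,u})>0$ for every $\gamma\in\mathcal{P}$ with $\gamma\neq\theta$; and (ii) (Assumption 3) $\lim_{t\to\infty}\pi_t(\theta\mid H_t)$ exists $\mathbb{P}^{\tau,\theta}_{x_0}$-almost surely. Then Thompson sampling exhibits complete learning: $$\lim_{t\to\infty}\pi_t(\theta\mid H_t)=1,\qquad \mathbb{P}^{\tau,\theta}_{x_0}\text{-almost surely}.$$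
   Context: Model. $\mathcal{X}$ (states) and $\mathcal{U}$ (controls) are Borel spaces; for each $x\in\mathcal{X}$, $\mathcal{U}(x)\subseteq\mathcal{U}$ is the compact set of admissible controls, $\mathcal{U}=\bigcup_x\mathcal{U}(x)$, and $\mathbb{K}=\{(x,u):x\in\mathcal{X},u\in\mathcal{U}(x)\}$ is measurable in $\mathcal{X}\times\mathcal{U}$. $\mathcal{P}$ is a finite parameter set; $\theta\in\mathcal{P}$ is the fixed true parameter, unknown to the decision-maker. $\mathscr{R}_c\subset\mathbb{R}_+$ is a compact measurable set of rewards. For each $\gamma\in\mathcal{P}$ and $(x,u)\in\mathbb{K}$, $f^\gamma(\cdot\mid x,u)$ is a measurable, continuous (in $r$) probability density on $\mathscr{R}_c$ with respect to a $\sigma$-finite measure $\lambda$, and $q^\gamma(\cdot\mid x,u)$ is a probability density on $\mathcal{X}$ with respect to a $\sigma$-finite measure $\eta$; $Q^\gamma(dy\mid x,u)=q^\gamma(y\mid x,u)\,d\eta(y)$ is the transition law and $r^\gamma(x,u)=\int_{\mathscr{R}_c} r f^\gamma(r\mid x,u)\,d\lambda(r)$ is the expected reward. $\beta\in[0,1)$ is the discount factor. Standing Assumption 1. For every $\gamma\in\mathcal{P}$ the equation $\nu^\gamma(x)=\sup_{u\in\mathcal{U}(x)}\{r^\gamma(x,u)+\beta\int\nu^\gamma(y)Q^\gamma(dy\mid x,u)\}$, $x\in\mathcal{X}$, has a unique solution $\nu^\gamma$, the supremum is attained, and there is a stationary deterministic Markov optimal policy $\mu^\gamma:\mathcal{X}\to\mathcal{U}$,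 $\mu^\gamma(x)\in\mathcal{U}(x)$, attaining it. Thompson sampling $\tau$. The history at time $t$ is $H_t=(X_0,\Theta_0,U_0,R_0,\dots,X_{t-1},\Theta_{t-1},U_{t-1},R_{t-1},X_t)$. A prior $\pi_0(\cdot\mid h_0)$ on $\mathcal{P}$, $h_0=x_0$, with $\pi_0(\gamma\mid h_0)>0$ for all $\gamma\in\mathcal{P}$ is given. The posterior is $$\pi_t(\gamma\mid H_t)=\frac{\mathcal{L}^\gamma_t(H_t)\pi_0(\gamma\mid h_0)}{\sum_{\gamma'\in\mathcal{P}}\mathcal{L}^{\gamma'}_t(H_t)\pi_0(\gamma'\mid h_0)},\qquad \mathcal{L}^\gamma_t(H_t)=\prod_{s=1}^t f^\gamma(R_{s-1}\mid X_{s-1},U_{s-1})\,q^\gamma(X_s\mid X_{s-1},U_{s-1}).$$ $\mathbb{P}^{\tau,\theta}_{x_0}$ is the unique probability measure on the space of infinite sequences $(X_0,\Theta_0,U_0,R_0,X_1,\dots)$ such that $X_0=x_0$ a.s. and, for each $t\ge0$: given $H_t$, $\Theta_t$ has law $\pi_t(\cdot\mid H_t)$; $U_t=\mu^{\Theta_t}(X_t)$; given $(H_t,\Theta_t,U_t)$, $R_t$ has density $f^\theta(\cdot\mid X_t,U_t)$; given $(H_t,\Theta_t,U_t,R_t)$, $X_{t+1}$ has density $q^\theta(\cdot\mid X_t,U_t)$. Relative entropy. $\rho^\gamma_{x,u}$ is the probability measure on $\mathscr{R}_c\times\mathcal{X}$ with density $f^\gamma(r\mid x,u)q^\gamma(y\mid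 x,u)$ with respect to $\lambda\otimes\eta$, and $\mathcal{K}(\rho^\theta_{x,u}\mid\rho^\gamma_{x,u})=\int\log\big(d\rho^\theta_{x,u}/d\rho^\gamma_{x,u}\big)\,d\rho^\theta_{x,u}$. *)

theory Defs
  imports "HOL-Probability.Probability"
begin

text \<open>
  A finite family of Markov decision problems. \<open>states\<close> and \<open>controls\<close> are Borel subsets of
  Polish spaces, i.e. Borel spaces; \<open>rew_base\<close> and \<open>st_base\<close> are the reference measures
  \<open>\<lambda>\<close> and \<open>\<eta>\<close>; \<open>rew_dens m \<gamma> r x u\<close> is \<open>f\<^sup>\<gamma>(r | x, u)\<close> and
  \<open>st_dens m \<gamma> y x u\<close> is \<open>q\<^sup>\<gamma>(y | x, u)\<close>.
\<close>

record ('x, 'u, 'p) mdp =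
  states :: "'x set"
  controls :: "'u set"
  adm :: "'x \<Rightarrow> 'u set"
  params :: "'p set"
  rewards :: "real set"
  rew_base :: "real measure"
  st_base :: "'x measure"
  rew_dens :: "'p \<Rightarrow> real \<Rightarrow> 'x \<Rightarrow> 'u \<Rightarrow> real"
  st_dens :: "'p \<Rightarrow> 'x \<Rightarrow> 'x \<Rightarrow> 'u \<Rightarrow> real"
  discount :: real

definition state_space :: "('x::polish_space, 'u, 'p) mdp \<Rightarrow> 'x measure" where
  "state_space m = restrict_space borel (states m)"

definition control_space :: "('x, 'u::polish_space, 'p) mdp \<Rightarrow> 'u measure" where
  "control_space m = restrict_space borel (controls m)"

definition reward_space :: "('x, 'u, 'p) mdp \<Rightarrow> real measure" where
  "reward_space m = restrict_space borel (rewards m)"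

definition graph :: "('x, 'u, 'p) mdp \<Rightarrow> ('x \<times> 'u) set" where
  "graph m = (SIGMA x:states m. adm m x)"

definition graph_space :: "('x::polish_space, 'u::polish_space, 'p) mdp \<Rightarrow> ('x \<times> 'u) measure" where
  "graph_space m = restrict_space (state_space m \<Otimes>\<^sub>M control_space m) (graph m)"

definition mdp_family :: "('x::polish_space, 'u::polish_space, 'p) mdp \<Rightarrow> bool" where
  "mdp_family m \<longleftrightarrow>
     states m \<in> sets borel \<and> controls m \<in> sets borel \<and>
     (\<forall>x\<in>states m. compact (adm m x)) \<and>
     controls m = (\<Union>x\<in>states m. adm m x) \<and>
     graph m \<in> sets (state_space m \<Otimes>\<^sub>M control_space m) \<and>
     finite (params m) \<and>
     compact (rewards m) \<and> rewards m \<subseteq> {0..} \<and>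
     sets (rew_base m) = sets (reward_space m) \<and> sigma_finite_measure (rew_base m) \<and>
     sets (st_base m) = sets (state_space m) \<and> sigma_finite_measure (st_base m) \<and>
     0 \<le> discount m \<and> discount m < 1 \<and>
     (\<forall>\<gamma>\<in>params m.
        (\<lambda>(r, x, u). rew_dens m \<gamma> r x u) \<in> borel_measurable (reward_space m \<Otimes>\<^sub>M graph_space m) \<and>
        (\<lambda>(y, x, u). st_dens m \<gamma> y x u) \<in> borel_measurable (state_space m \<Otimes>\<^sub>M graph_space m) \<and>
        (\<forall>(x, u)\<in>graph m.
           continuous_on (rewards m) (\<lambda>r. rew_dens m \<gamma> r x u) \<and>
           (\<forall>r\<in>rewards m. 0 \<le> rew_dens m \<gamma> r x u) \<and>
           (\<integral>\<^sup>+ r. ennreal (rew_dens m \<gamma> r x u) \<partial>rew_base m) = 1 \<and>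
           (\<forall>y\<in>states m. 0 \<le> st_dens m \<gamma> y x u) \<and>
           (\<integral>\<^sup>+ y. ennreal (st_dens m \<gamma> y x u) \<partial>st_base m) = 1))"

definition reward_law :: "('x, 'u, 'p) mdp \<Rightarrow> 'p \<Rightarrow> 'x \<Rightarrow> 'u \<Rightarrow> real measure" where
  "reward_law m \<gamma> x u = density (rew_base m) (\<lambda>r. ennreal (rew_dens m \<gamma> r x u))"

definition transition_law :: "('x, 'u, 'p) mdp \<Rightarrow> 'p \<Rightarrow> 'x \<Rightarrow> 'u \<Rightarrow> 'x measure" where
  "transition_law m \<gamma> x u = density (st_base m) (\<lambda>y. ennreal (st_dens m \<gamma> y x u))"

definition exp_reward :: "('x, 'u, 'p) mdp \<Rightarrow> 'p \<Rightarrow> 'x \<Rightarrow> 'u \<Rightarrow> real" where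
  "exp_reward m \<gamma> x u = (\<integral>r. r * rew_dens m \<gamma> r x u \<partial>rew_base m)"

definition action_value ::
    "('x, 'u, 'p) mdp \<Rightarrow> 'p \<Rightarrow> ('x \<Rightarrow> real) \<Rightarrow> 'x \<Rightarrow> 'u \<Rightarrow> real" where
  "action_value m \<gamma> \<nu> x u =
     exp_reward m \<gamma> x u + discount m * (\<integral>y. \<nu> y \<partial>transition_law m \<gamma> x u)"

text \<open>
  Solutions of the optimality equation are sought among the bounded measurable functions, on which
  all integrals and suprema involved are finite (\<open>rewards m\<close> is bounded).
\<close>

definition bellman_solution ::
    "('x::polish_space, 'u, 'p) mdp \<Rightarrow> 'p \<Rightarrow> ('x \<Rightarrow> real) \<Rightarrow> bool" where
  "bellman_solution m \<gamma> \<nu> \<longleftrightarrow>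
     \<nu> \<in> borel_measurable (state_space m) \<and> bounded (\<nu> ` states m) \<and>
     (\<forall>x\<in>states m. \<nu> x = (SUP u\<in>adm m x. action_value m \<gamma> \<nu> x u))"

definition optimal_policies ::
    "('x::polish_space, 'u::polish_space, 'p) mdp \<Rightarrow> ('p \<Rightarrow> 'x \<Rightarrow> 'u) \<Rightarrow> bool" where
  "optimal_policies m \<mu> \<longleftrightarrow>
     (\<forall>\<gamma>\<in>params m. \<exists>\<nu>.
        bellman_solution m \<gamma> \<nu> \<and>
        (\<forall>\<nu>'. bellman_solution m \<gamma> \<nu>' \<longrightarrow> (\<forall>x\<in>states m. \<nu>' x = \<nu> x)) \<and>
        \<mu> \<gamma> \<in> state_space m \<rightarrow>\<^sub>M control_space m \<and>
        (\<forall>x\<in>states m. \<mu> \<gamma> x \<in> adm m x \<and> \<nu> x = action_value m \<gamma> \<nu> x (\<mu> \<gamma> x)))"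

definition joint_law :: "('x, 'u, 'p) mdp \<Rightarrow> 'p \<Rightarrow> 'x \<Rightarrow> 'u \<Rightarrow> (real \<times> 'x) measure" where
  "joint_law m \<gamma> x u =
     density (rew_base m \<Otimes>\<^sub>M st_base m) (\<lambda>(r, y). ennreal (rew_dens m \<gamma> r x u * st_dens m \<gamma> y x u))"

text \<open>
  \<open>rel_entropy P Q\<close> is \<open>\<integral> ln (dP/dQ) dP\<close> for \<open>P \<lless> Q\<close>, with value \<open>\<infinity>\<close> where the integral diverges.
  The library's \<open>KL_divergence\<close> is the same Bochner integral, but it is 0 in the divergent case.
\<close>

definition rel_entropy :: "'a measure \<Rightarrow> 'a measure \<Rightarrow> ereal" where
  "rel_entropy P Q =
     enn2ereal (\<integral>\<^sup>+ z. ennreal (entropy_density (exp 1) Q P z) \<partial>P) -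
     enn2ereal (\<integral>\<^sup>+ z. ennreal (- entropy_density (exp 1) Q P z) \<partial>P)"

lemma rel_entropy_eq_KL_divergence:
  assumes "integrable P (entropy_density (exp 1) Q P)"
  shows "rel_entropy P Q = ereal (KL_divergence (exp 1) Q P)"
proof -
  let ?a = "\<integral>\<^sup>+ z. ennreal (entropy_density (exp 1) Q P z) \<partial>P"
  let ?b = "\<integral>\<^sup>+ z. ennreal (- entropy_density (exp 1) Q P z) \<partial>P"
  have "?a \<noteq> \<infinity>" "?b \<noteq> \<infinity>"
    using assms unfolding real_integrable_def by auto
  then have "enn2ereal ?a = ereal (enn2real ?a)" "enn2ereal ?b = ereal (enn2real ?b)"
    by (cases ?a; cases ?b; simp)+
  then show ?thesis
    unfolding rel_entropy_def KL_divergence_def real_lebesgue_integral_def[OF assms] by simp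
qed

text \<open>
  A trajectory \<open>\<omega>\<close> is the sequence of the tuples \<open>(X\<^sub>t, \<Theta>\<^sub>t, U\<^sub>t, R\<^sub>t)\<close>.
\<close>

type_synonym ('x, 'p, 'u) traj = "nat \<Rightarrow> 'x \<times> 'p \<times> 'u \<times> real"

definition X_at :: "nat \<Rightarrow> ('x, 'p, 'u) traj \<Rightarrow> 'x" where
  "X_at t \<omega> = fst (\<omega> t)"

definition Theta_at :: "nat \<Rightarrow> ('x, 'p, 'u) traj \<Rightarrow> 'p" where
  "Theta_at t \<omega> = fst (snd (\<omega> t))"

definition U_at :: "nat \<Rightarrow> ('x, 'p, 'u) traj \<Rightarrow> 'u" where
  "U_at t \<omega> = fst (snd (snd (\<omega> t)))"

definition R_at :: "nat \<Rightarrow> ('x, 'p, 'u) traj \<Rightarrow> real" where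
  "R_at t \<omega> = snd (snd (snd (\<omega> t)))"

definition step_space ::
    "('x::polish_space, 'u::polish_space, 'p) mdp \<Rightarrow> ('x \<times> 'p \<times> 'u \<times> real) measure" where
  "step_space m =
     state_space m \<Otimes>\<^sub>M (count_space (params m) \<Otimes>\<^sub>M (control_space m \<Otimes>\<^sub>M reward_space m))"

definition traj_space ::
    "('x::polish_space, 'u::polish_space, 'p) mdp \<Rightarrow> ('x, 'p, 'u) traj measure" where
  "traj_space m = (\<Pi>\<^sub>M t\<in>UNIV. step_space m)"

text \<open>The history \<open>H\<^sub>t\<close>: the tuples at times before \<open>t\<close>, together with \<open>X\<^sub>t\<close>.\<close>

definition hist ::
    "nat \<Rightarrow> ('x, 'p, 'u) traj \<Rightarrow> ('x, 'p, 'u) traj \<times> 'x" where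
  "hist t \<omega> = (restrict \<omega> {..<t}, X_at t \<omega>)"

definition hist_space ::
    "('x::polish_space, 'u::polish_space, 'p) mdp \<Rightarrow> nat \<Rightarrow> (('x, 'p, 'u) traj \<times> 'x) measure" where
  "hist_space m t = (\<Pi>\<^sub>M s\<in>{..<t}. step_space m) \<Otimes>\<^sub>M state_space m"

text \<open>Likelihood and posterior depend on \<open>\<omega>\<close> through \<open>hist t \<omega>\<close> only.\<close>

definition likelihood ::
    "('x, 'u, 'p) mdp \<Rightarrow> 'p \<Rightarrow> nat \<Rightarrow> ('x, 'p, 'u) traj \<Rightarrow> real" where
  "likelihood m \<gamma> t \<omega> =
     (\<Prod>s=1..t. rew_dens m \<gamma> (R_at (s - 1) \<omega>) (X_at (s - 1) \<omega>) (U_at (s - 1) \<omega>) *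
               st_dens m \<gamma> (X_at s \<omega>) (X_at (s - 1) \<omega>) (U_at (s - 1) \<omega>))"

definition posterior ::
    "('x, 'u, 'p) mdp \<Rightarrow> ('p \<Rightarrow> real) \<Rightarrow> 'p \<Rightarrow> nat \<Rightarrow> ('x, 'p, 'u) traj \<Rightarrow> real" where
  "posterior m prior \<gamma> t \<omega> =
     likelihood m \<gamma> t \<omega> * prior \<gamma> / (\<Sum>\<gamma>'\<in>params m. likelihood m \<gamma>' t \<omega> * prior \<gamma>')"

text \<open>
  \<open>has_cond_law M N V S Y \<kappa>\<close>: under \<open>M\<close>, the conditional law of the \<open>S\<close>-valued variable \<open>Y\<close>
  given the \<open>N\<close>-valued variable \<open>V\<close> is \<open>\<omega> \<mapsto> \<kappa> \<omega>\<close>.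
\<close>

definition has_cond_law ::
    "'w measure \<Rightarrow> 'v measure \<Rightarrow> ('w \<Rightarrow> 'v) \<Rightarrow> 's measure \<Rightarrow> ('w \<Rightarrow> 's) \<Rightarrow> ('w \<Rightarrow> 's measure) \<Rightarrow> bool"
  where
  "has_cond_law M N V S Y \<kappa> \<longleftrightarrow>
     V \<in> M \<rightarrow>\<^sub>M N \<and> Y \<in> M \<rightarrow>\<^sub>M S \<and>
     (\<forall>B\<in>sets S. AE \<omega> in M.
        real_cond_exp M (vimage_algebra (space M) V N) (indicator (Y -` B \<inter> space M)) \<omega> =
        measure (\<kappa> \<omega>) B)"

text \<open>
  The defining properties of the law of the process under Thompson sampling started in \<open>x0\<close>, with
  true parameter \<open>\<theta>\<close>; by the Ionescu-Tulcea theorem exactly one measure has them, provided that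
  the posterior is always well-defined.
\<close>

definition thompson_law ::
    "('x::polish_space, 'u::polish_space, 'p) mdp \<Rightarrow> ('p \<Rightarrow> 'x \<Rightarrow> 'u) \<Rightarrow> ('p \<Rightarrow> real) \<Rightarrow> 'p \<Rightarrow> 'x \<Rightarrow>
     ('x, 'p, 'u) traj measure \<Rightarrow> bool" where
  "thompson_law m \<mu> prior \<theta> x0 M \<longleftrightarrow>
     prob_space M \<and> sets M = sets (traj_space m) \<and>
     (AE \<omega> in M. X_at 0 \<omega> = x0) \<and>
     (\<forall>t.
       has_cond_law M (hist_space m t) (hist t)
         (count_space (params m)) (Theta_at t)
         (\<lambda>\<omega>. point_measure (params m) (\<lambda>\<gamma>. ennreal (posterior m prior \<gamma> t \<omega>))) \<and>
       (AE \<omega> in M. U_at t \<omega> = \<mu> (Theta_at t \<omega>) (X_at t \<omega>)) \<and>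
       has_cond_law M
         (hist_space m t \<Otimes>\<^sub>M (count_space (params m) \<Otimes>\<^sub>M control_space m))
         (\<lambda>\<omega>. (hist t \<omega>, Theta_at t \<omega>, U_at t \<omega>))
         (reward_space m) (R_at t)
         (\<lambda>\<omega>. reward_law m \<theta> (X_at t \<omega>) (U_at t \<omega>)) \<and>
       has_cond_law M
         (hist_space m t \<Otimes>\<^sub>M (count_space (params m) \<Otimes>\<^sub>M (control_space m \<Otimes>\<^sub>M reward_space m)))
         (\<lambda>\<omega>. (hist t \<omega>, Theta_at t \<omega>, U_at t \<omega>, R_at t \<omega>))
         (state_space m) (X_at (Suc t))
         (\<lambda>\<omega>. transition_law m \<theta> (X_at t \<omega>) (U_at t \<omega>)))"

text \<open>
  The infima of the densities are infima in \<open>real\<close>; they are not degenerate, as the densities are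
  nonnegative and \<open>graph m\<close>, \<open>rewards m\<close>, \<open>states m\<close> are nonempty wherever this is used.
\<close>

definition densities_bounded_below :: "('x, 'u, 'p) mdp \<Rightarrow> bool" where
  "densities_bounded_below m \<longleftrightarrow>
     (\<forall>\<gamma>\<in>params m.
        (INF ((x, u), r)\<in>graph m \<times> rewards m. rew_dens m \<gamma> r x u) > 0 \<and>
        (INF ((x, u), y)\<in>graph m \<times> states m. st_dens m \<gamma> y x u) > 0)"

definition entropy_separated :: "('x, 'u, 'p) mdp \<Rightarrow> 'p \<Rightarrow> bool" where
  "entropy_separated m \<theta> \<longleftrightarrow>
     (\<forall>\<gamma>\<in>params m. \<gamma> \<noteq> \<theta> \<longrightarrow>
        (INF (x, u)\<in>graph m. rel_entropy (joint_law m \<theta> x u) (joint_law m \<gamma> x u)) > 0)"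

end

theory Submission
  imports Defs
begin

text \<open>
  Let \<open>W\<^sub>t\<close> be the square root of the likelihood ratio of \<open>\<gamma> \<noteq> \<theta>\<close> against \<open>\<theta>\<close>. Given the past, its
  expected growth factor over one step is the Hellinger affinity \<open>\<integral> \<surd>(d\<rho>\<^sup>\<theta> d\<rho>\<^sup>\<gamma>)\<close> at \<open>(X\<^sub>t, U\<^sub>t)\<close>,
  which is at most 1 and, as the relative entropy is positive, pointwise less than 1. As there are
  finitely many policies, the affinity is at most \<open>1 - \<kappa>\<close> for all of them on a set \<open>A\<close> of states with
  \<open>\<eta>(A) > 0\<close>; since the transition densities are bounded below, \<open>A\<close> is visited with a probability
  bounded away from 0. Hence \<open>E W\<^sub>t\<close> decays geometrically, and \<open>W\<^sub>t \<rightarrow> 0\<close> almost surely.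
\<close>

section \<open>Integrating out a variable that has a conditional density\<close>

text \<open>\<open>has_cond_law\<close> speaks about one event \<open>B\<close> at a time, with an
  exceptional null set depending on \<open>B\<close>. The lemma turns this into a disintegration: on
  the product of the sigma-algebra generated by \<open>V\<close> with \<open>S\<close>, the law of
  \<open>(\<omega>, Y \<omega>)\<close> has density \<open>h\<close> with respect to the product of
  \<open>M\<close> and \<open>L\<close>. It suffices to compare both measures on rectangles, where
  the claim is the defining property of the conditional expectation.\<close>

lemma nn_integral_cond_law_density:
  fixes g h :: "'w \<times> 's \<Rightarrow> ennreal"
  assumes "prob_space M" and law: "has_cond_law M N V S Y \<kappa>"
    and L: "sets L = sets S" "sigma_finite_measure L"
    and h: "h \<in> borel_measurable (vimage_algebra (space M) V N \<Otimes>\<^sub>M S)"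
    and g: "g \<in> borel_measurable (vimage_algebra (space M) V N \<Otimes>\<^sub>M S)"
    and \<kappa>: "AE \<omega> in M. prob_space (\<kappa> \<omega>) \<and> \<kappa> \<omega> = density L (\<lambda>y. h (\<omega>, y))"
  shows "(\<integral>\<^sup>+ \<omega>. g (\<omega>, Y \<omega>) \<partial>M) = (\<integral>\<^sup>+ \<omega>. \<integral>\<^sup>+ y. h (\<omega>, y) * g (\<omega>, y) \<partial>L \<partial>M)"
proof -
  interpret prob_space M by fact
  interpret L: sigma_finite_measure L by fact
  define F where "F = vimage_algebra (space M) V N"
  have V[measurable]: "V \<in> M \<rightarrow>\<^sub>M N" and Y[measurable]: "Y \<in> M \<rightarrow>\<^sub>M S"
    using law by (auto simp: has_cond_law_def)
  have spF: "space F = space M" by (simp add: F_def)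
  have subF: "subalgebra M F"
    using measurable_space[OF V] measurable_sets[OF V] unfolding subalgebra_def spF
    by (auto simp: F_def sets_vimage_algebra2)
  then interpret fin: finite_measure_subalgebra M F
    by unfold_locales
  \<comment> \<open>\<open>M'\<close> is \<open>M\<close> restricted to \<open>F\<close>. The
    product \<open>M' \<Otimes>\<^sub>M L\<close> then has the same measurable sets as
    \<open>F \<Otimes>\<^sub>M S\<close>, on which \<open>h\<close> and \<open>g\<close> are
    measurable, and integrals of \<open>F\<close>-measurable functions are the same under
    \<open>M\<close> and \<open>M'\<close>.\<close>
  define M' where "M' = restr_to_subalg M F"
  interpret M': prob_space M' unfolding M'_def by (rule prob_space_restr_to_subalg) fact+
  have setsM'[measurable_cong]: "sets M' = sets F" unfolding M'_def by (rule sets_restr_to_subalg[OF subF])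
  note L(1)[measurable_cong]
  have h'[measurable]: "h \<in> borel_measurable (F \<Otimes>\<^sub>M S)" and g'[measurable]: "g \<in> borel_measurable (F \<Otimes>\<^sub>M S)"
    using h g by (simp_all add: F_def)
  have idF: "(\<lambda>\<omega>. \<omega>) \<in> M \<rightarrow>\<^sub>M F"
    using subF by (auto simp: measurable_def subalgebra_def)
  have pairY[measurable]: "(\<lambda>\<omega>. (\<omega>, Y \<omega>)) \<in> M \<rightarrow>\<^sub>M F \<Otimes>\<^sub>M S"
    using idF Y by (rule measurable_Pair)
  let ?P = "distr M (F \<Otimes>\<^sub>M S) (\<lambda>\<omega>. (\<omega>, Y \<omega>))"
  let ?Q = "density (M' \<Otimes>\<^sub>M L) h"
  let ?E = "{a \<times> b |a b. a \<in> sets F \<and> b \<in> sets S}"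
  have rect: "emeasure ?P (A \<times> B) = emeasure ?Q (A \<times> B)" if A[measurable]: "A \<in> sets F" and B[measurable]: "B \<in> sets S" for A B
  proof -
    let ?i = "indicator (Y -` B \<inter> space M) :: _ \<Rightarrow> real"
    \<comment> \<open>The conditional expectation is real-valued and the integral against
      \<open>L\<close> is not, hence the passage through \<open>enn2real\<close>. Nothing is lost
      almost everywhere: \<open>\<kappa> \<omega>\<close> is a probability measure, so the integral
      is at most 1.\<close>
    define G where "G \<omega> = enn2real (\<integral>\<^sup>+ y. h (\<omega>, y) * indicator B y \<partial>L)" for \<omega>
    have GF[measurable]: "G \<in> borel_measurable F" unfolding G_def by measurable
    have GM[measurable]: "G \<in> borel_measurable M" by (rule measurable_from_subalg[OF subF GF])
    have [measurable]: "(\<lambda>\<omega>. real_cond_exp M F (indicator (Y -` B \<inter> space M)) \<omega>) \<in> borel_measurable M"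
      by (rule measurable_from_subalg[OF subF]) simp
    have G_eq: "AE \<omega> in M. measure (\<kappa> \<omega>) B = G \<omega> \<and> G \<omega> \<le> 1 \<and>
        ennreal (G \<omega>) = (\<integral>\<^sup>+ y. h (\<omega>, y) * indicator B y \<partial>L)"
      using \<kappa> AE_space
    proof eventually_elim
      case (elim \<omega>)
      then interpret K: prob_space "\<kappa> \<omega>" by blast
      from elim have "(\<lambda>y. h (\<omega>, y)) \<in> borel_measurable L"
        by (intro measurable_compose[OF _ h']) (simp add: spF)
      then have "emeasure (\<kappa> \<omega>) B = (\<integral>\<^sup>+ y. h (\<omega>, y) * indicator B y \<partial>L)"
        using elim by (simp add: emeasure_density L)
      then have "(\<integral>\<^sup>+ y. h (\<omega>, y) * indicator B y \<partial>L) = ennreal (measure (\<kappa> \<omega>) B)"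
        by (simp add: K.emeasure_eq_measure)
      then show ?case by (simp add: G_def)
    qed
    have AM[measurable]: "A \<in> sets M" using A subF by (auto simp: subalgebra_def)
    have "emeasure ?P (A \<times> B) = emeasure M (A \<inter> (Y -` B \<inter> space M))"
      using sets.sets_into_space[OF AM]
      by (subst emeasure_distr) (auto intro!: arg_cong[where f="emeasure M"])
    also have "\<dots> = ennreal (measure M (A \<inter> (Y -` B \<inter> space M)))"
      by (simp add: emeasure_eq_measure)
    also have "measure M (A \<inter> (Y -` B \<inter> space M)) = (\<integral>\<omega>\<in>A. ?i \<omega> \<partial>M)"
      unfolding set_lebesgue_integral_def
      by (simp add: indicator_inter_arith[symmetric] Int_ac)
    also have "\<dots> = (\<integral>\<omega>\<in>A. real_cond_exp M F ?i \<omega> \<partial>M)"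
      by (rule fin.real_cond_exp_intA) (auto intro!: integrable_real_indicator simp: less_top[symmetric])
    also have "\<dots> = (\<integral>\<omega>. indicator A \<omega> * G \<omega> \<partial>M)"
    proof -
      have "AE \<omega> in M. real_cond_exp M F ?i \<omega> = measure (\<kappa> \<omega>) B"
        using law B unfolding has_cond_law_def F_def by blast
      with G_eq show ?thesis
        unfolding set_lebesgue_integral_def by (intro integral_cong_AE) (measurable, auto)
    qed
    also have "ennreal \<dots> = (\<integral>\<^sup>+ \<omega>. ennreal (indicator A \<omega> * G \<omega>) \<partial>M)"
    proof (rule nn_integral_eq_integral[symmetric])
      show "integrable M (\<lambda>\<omega>. indicator A \<omega> * G \<omega>)"
        using G_eq by (intro integrable_const_bound[where B=1]) (auto split: split_indicator simp: G_def)
    qed (simp add: G_def)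
    also have "\<dots> = (\<integral>\<^sup>+ \<omega>. indicator A \<omega> * (\<integral>\<^sup>+ y. h (\<omega>, y) * indicator B y \<partial>L) \<partial>M)"
      using G_eq by (intro nn_integral_cong_AE) (auto split: split_indicator)
    also have "\<dots> = (\<integral>\<^sup>+ \<omega>. indicator A \<omega> * (\<integral>\<^sup>+ y. h (\<omega>, y) * indicator B y \<partial>L) \<partial>M')"
      unfolding M'_def by (rule nn_integral_subalgebra2[OF subF, symmetric]) measurable
    also have "\<dots> = (\<integral>\<^sup>+ \<omega>. \<integral>\<^sup>+ y. h (\<omega>, y) * indicator (A \<times> B) (\<omega>, y) \<partial>L \<partial>M')"
      by (intro nn_integral_cong) (auto simp: indicator_times split: split_indicator)
    also have "\<dots> = emeasure ?Q (A \<times> B)"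
      by (subst emeasure_density, measurable)
         (subst L.nn_integral_fst[symmetric], measurable)
    finally show ?thesis .
  qed
  \<comment> \<open>Rectangles form an intersection-stable generator. Since \<open>?P\<close> is
    finite, the constant sequence of the whole space exhausts it.\<close>
  have "?P = ?Q"
  proof (rule measure_eqI_generator_eq[OF Int_stable_pair_measure_generator[of F S], where A="\<lambda>_. space F \<times> space S"])
    show "?E \<subseteq> Pow (space F \<times> space S)"
      by (rule pair_measure_closed)
    show "sets ?P = sigma_sets (space F \<times> space S) ?E" by (simp add: sets_pair_measure)
    have "sets ?Q = sets (F \<Otimes>\<^sub>M S)" by (simp add: L setsM' cong: sets_pair_measure_cong)
    then show "sets ?Q = sigma_sets (space F \<times> space S) ?E"
      by (simp add: sets_pair_measure)
    show "emeasure ?P (space F \<times> space S) \<noteq> \<infinity>" for i :: nat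
      by (subst emeasure_distr) (auto simp: space_pair_measure intro: sets.top[of "F \<Otimes>\<^sub>M S", unfolded space_pair_measure])
  qed (auto simp: rect)
  then have "(\<integral>\<^sup>+ z. g z \<partial>?P) = (\<integral>\<^sup>+ z. g z \<partial>?Q)" by simp
  moreover have "(\<integral>\<^sup>+ z. g z \<partial>?P) = (\<integral>\<^sup>+ \<omega>. g (\<omega>, Y \<omega>) \<partial>M)"
    by (rule nn_integral_distr) measurable
  moreover have "(\<integral>\<^sup>+ z. g z \<partial>?Q) = (\<integral>\<^sup>+ z. h z * g z \<partial>(M' \<Otimes>\<^sub>M L))"
    by (rule nn_integral_density) measurable
  moreover have "\<dots> = (\<integral>\<^sup>+ \<omega>. \<integral>\<^sup>+ y. h (\<omega>, y) * g (\<omega>, y) \<partial>L \<partial>M')"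
    by (subst L.nn_integral_fst[symmetric]) measurable
  moreover have "\<dots> = (\<integral>\<^sup>+ \<omega>. \<integral>\<^sup>+ y. h (\<omega>, y) * g (\<omega>, y) \<partial>L \<partial>M)"
    unfolding M'_def by (rule nn_integral_subalgebra2[OF subF]) measurable
  ultimately show ?thesis by simp
qed

section \<open>Hellinger affinity, vanishing relative entropy and geometric decay\<close>

text \<open>The first integral is the Hellinger affinity, the second half the squared Hellinger
  distance. Pointwise, the integrands add up to the arithmetic mean of \<open>f x\<close> and
  \<open>g x\<close>. The sum form avoids truncated subtraction in \<open>ennreal\<close>, and it
  yields both the bound by 1 and the case of equality.\<close>

lemma nn_integral_sqrt_mult_add_gap:
  fixes f g :: "'a \<Rightarrow> real"
  assumes [measurable]: "f \<in> borel_measurable M" "g \<in> borel_measurable M"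
    and nonneg: "\<And>x. x \<in> space M \<Longrightarrow> 0 \<le> f x" "\<And>x. x \<in> space M \<Longrightarrow> 0 \<le> g x"
    and int: "(\<integral>\<^sup>+ x. ennreal (f x) \<partial>M) = 1" "(\<integral>\<^sup>+ x. ennreal (g x) \<partial>M) = 1"
  shows "(\<integral>\<^sup>+ x. ennreal (sqrt (f x * g x)) \<partial>M)
    + (\<integral>\<^sup>+ x. ennreal ((sqrt (f x) - sqrt (g x))\<^sup>2 / 2) \<partial>M) = 1"
proof -
  have "(\<integral>\<^sup>+ x. ennreal (sqrt (f x * g x)) \<partial>M) + (\<integral>\<^sup>+ x. ennreal ((sqrt (f x) - sqrt (g x))\<^sup>2 / 2) \<partial>M)
      = (\<integral>\<^sup>+ x. ennreal (sqrt (f x * g x)) + ennreal ((sqrt (f x) - sqrt (g x))\<^sup>2 / 2) \<partial>M)"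
    by (rule nn_integral_add[symmetric]) measurable
  also have "\<dots> = (\<integral>\<^sup>+ x. (ennreal (f x) + ennreal (g x)) / 2 \<partial>M)"
  proof (rule nn_integral_cong)
    fix x assume x: "x \<in> space M"
    have "sqrt (f x * g x) + (sqrt (f x) - sqrt (g x))\<^sup>2 / 2 = (f x + g x) / 2"
      using nonneg[OF x] by (simp add: power2_diff real_sqrt_mult field_simps)
    then have "ennreal (sqrt (f x * g x) + (sqrt (f x) - sqrt (g x))\<^sup>2 / 2) = ennreal ((f x + g x) / 2)"
      by (rule arg_cong)
    then show "ennreal (sqrt (f x * g x)) + ennreal ((sqrt (f x) - sqrt (g x))\<^sup>2 / 2)
        = (ennreal (f x) + ennreal (g x)) / 2"
      using nonneg[OF x] by (simp add: ennreal_plus divide_ennreal[symmetric, of "f x + g x" 2])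
  qed
  also have "\<dots> = 1"
    by (simp add: nn_integral_add nn_integral_divide int one_add_one)
  finally show ?thesis .
qed

lemma nn_integral_sqrt_mult_le_1:
  fixes f g :: "'a \<Rightarrow> real"
  assumes "f \<in> borel_measurable M" "g \<in> borel_measurable M"
    and "\<And>x. x \<in> space M \<Longrightarrow> 0 \<le> f x" "\<And>x. x \<in> space M \<Longrightarrow> 0 \<le> g x"
    and "(\<integral>\<^sup>+ x. ennreal (f x) \<partial>M) = 1" "(\<integral>\<^sup>+ x. ennreal (g x) \<partial>M) = 1"
  shows "(\<integral>\<^sup>+ x. ennreal (sqrt (f x * g x)) \<partial>M) \<le> 1"
  by (rule order_trans[OF _ eq_refl[OF nn_integral_sqrt_mult_add_gap[OF assms]]]) simp

text \<open>If the affinity is 1, cancelling this finite value leaves a Hellinger distance of 0, so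
  the square roots agree almost everywhere.\<close>

lemma nn_integral_sqrt_mult_eq_1D:
  fixes f g :: "'a \<Rightarrow> real"
  assumes [measurable]: "f \<in> borel_measurable M" "g \<in> borel_measurable M"
    and nonneg: "\<And>x. x \<in> space M \<Longrightarrow> 0 \<le> f x" "\<And>x. x \<in> space M \<Longrightarrow> 0 \<le> g x"
    and int: "(\<integral>\<^sup>+ x. ennreal (f x) \<partial>M) = 1" "(\<integral>\<^sup>+ x. ennreal (g x) \<partial>M) = 1"
    and eq: "(\<integral>\<^sup>+ x. ennreal (sqrt (f x * g x)) \<partial>M) = 1"
  shows "AE x in M. f x = g x"
proof -
  have "(\<integral>\<^sup>+ x. ennreal ((sqrt (f x) - sqrt (g x))\<^sup>2 / 2) \<partial>M) = 0"
    using nn_integral_sqrt_mult_add_gap[OF assms(1-6)] unfolding eq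
    using ennreal_add_left_cancel[of 1 _ 0] by simp
  then have "AE x in M. ennreal ((sqrt (f x) - sqrt (g x))\<^sup>2 / 2) = 0"
    by (subst (asm) nn_integral_0_iff_AE) measurable
  then show ?thesis
    by eventually_elim (simp add: ennreal_eq_0_iff)
qed

text \<open>Sigma-finiteness makes the Radon-Nikodym derivative of \<open>M\<close> with respect to
  itself almost everywhere 1, and its logarithm 0.\<close>

lemma (in sigma_finite_measure) rel_entropy_same: "rel_entropy M M = 0"
proof -
  have "AE x in M. 1 = RN_deriv M M x"
    by (rule RN_deriv_unique) (simp_all add: density_1)
  then have ae: "AE x in M. entropy_density (exp 1) M M x = 0"
    by eventually_elim (simp add: entropy_density_def flip: One_nat_def)
  have "(\<integral>\<^sup>+ z. ennreal (entropy_density (exp 1) M M z) \<partial>M) = (\<integral>\<^sup>+ z. 0 \<partial>M)"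
    "(\<integral>\<^sup>+ z. ennreal (- entropy_density (exp 1) M M z) \<partial>M) = (\<integral>\<^sup>+ z. 0 \<partial>M)"
    by (rule nn_integral_cong_AE, use ae in \<open>eventually_elim, simp\<close>)+
  then show ?thesis
    unfolding rel_entropy_def by simp
qed

text \<open>Change of measure: the root of the density ratio, weighted by the true density
  \<open>a\<close>, is the integrand of the affinity. For \<open>a = 0\<close> both sides
  vanish.\<close>

lemma real_mult_sqrt_divide:
  assumes "0 \<le> a" "0 \<le> (b::real)"
  shows "a * sqrt (b / a) = sqrt (a * b)"
proof (cases "a = 0")
  case False
  then have "a * sqrt (b / a) = a / sqrt a * sqrt b" by (simp add: real_sqrt_divide)
  then show ?thesis using assms by (simp add: real_div_sqrt real_sqrt_mult)
qed simp

text \<open>The expectation of the series is bounded by a convergent geometric series, so the series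
  is almost surely finite and its terms tend to 0.\<close>

lemma AE_tendsto_0_of_geometric:
  fixes f :: "nat \<Rightarrow> 'a \<Rightarrow> real"
  assumes [measurable]: "\<And>n. f n \<in> borel_measurable M" and nonneg: "\<And>n x. 0 \<le> f n x"
    and bound: "\<And>n. (\<integral>\<^sup>+ x. ennreal (f n x) \<partial>M) \<le> ennreal (r ^ n)" and r: "0 \<le> r" "r < 1"
  shows "AE x in M. (\<lambda>n. f n x) \<longlonglongrightarrow> 0"
proof -
  have "(\<integral>\<^sup>+ x. (\<Sum>n. ennreal (f n x)) \<partial>M) = (\<Sum>n. \<integral>\<^sup>+ x. ennreal (f n x) \<partial>M)"
    by (rule nn_integral_suminf) measurable
  also have "\<dots> \<le> (\<Sum>n. ennreal (r ^ n))"
    by (intro suminf_le bound) auto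
  also have "\<dots> < \<infinity>"
    using r by (subst suminf_ennreal2) (auto simp: summable_geometric)
  finally have "AE x in M. (\<Sum>n. ennreal (f n x)) \<noteq> \<infinity>"
    by (intro nn_integral_PInf_AE) auto
  then show ?thesis
    by eventually_elim (auto intro!: summable_LIMSEQ_zero summable_suminf_not_top nonneg)
qed

section \<open>The setting: extended densities, affinities and their measurability\<close>

locale thompson_sampling =
  fixes m :: "('x::polish_space, 'u::polish_space, 'p) mdp"
    and \<mu> :: "'p \<Rightarrow> 'x \<Rightarrow> 'u"
    and prior :: "'p \<Rightarrow> real"
    and \<theta> :: 'p
    and x0 :: 'x
    and M :: "('x, 'p, 'u) traj measure"
  assumes family: "mdp_family m"
    and true_param: "\<theta> \<in> params m"
    and policies: "optimal_policies m \<mu>"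
    and law: "thompson_law m \<mu> prior \<theta> x0 M"
    and lower: "densities_bounded_below m"
begin

abbreviation "\<S> \<equiv> state_space m"
abbreviation "\<C> \<equiv> control_space m"
abbreviation "\<R> \<equiv> reward_space m"

text \<open>The given densities are measurable only over \<open>graph m\<close>, whereas
  \<open>(X_at t \<omega>, U_at t \<omega>)\<close> lies in the graph only almost surely. Extension
  by 0 gives functions that are measurable on the full product space and nonnegative there.\<close>

definition rdens :: "'p \<Rightarrow> real \<Rightarrow> 'x \<Rightarrow> 'u \<Rightarrow> real" where
  "rdens \<gamma> r x u = (if \<gamma> \<in> params m \<and> (x, u) \<in> graph m then rew_dens m \<gamma> r x u else 0)"

definition sdens :: "'p \<Rightarrow> 'x \<Rightarrow> 'x \<Rightarrow> 'u \<Rightarrow> real" where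
  "sdens \<gamma> y x u = (if \<gamma> \<in> params m \<and> (x, u) \<in> graph m then st_dens m \<gamma> y x u else 0)"

text \<open>Hellinger affinity of the reward densities of \<open>\<theta>\<close> and
  \<open>\<gamma>\<close>.\<close>

definition raff :: "'p \<Rightarrow> 'x \<Rightarrow> 'u \<Rightarrow> ennreal" where
  "raff \<gamma> x u = (\<integral>\<^sup>+ r. ennreal (sqrt (rdens \<theta> r x u * rdens \<gamma> r x u)) \<partial>rew_base m)"

text \<open>Hellinger affinity of the transition densities with a weight \<open>\<phi>\<close> on
  the next state. With \<open>\<phi> = 1\<close> it is the affinity itself, and
  \<open>raff \<gamma> x u * saff \<gamma> (\<lambda>_. 1) x u\<close> is that of the joint
  laws.\<close>

definition saff :: "'p \<Rightarrow> ('x \<Rightarrow> ennreal) \<Rightarrow> 'x \<Rightarrow> 'u \<Rightarrow> ennreal" where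
  "saff \<gamma> \<phi> x u = (\<integral>\<^sup>+ y. ennreal (sqrt (sdens \<theta> y x u * sdens \<gamma> y x u)) * \<phi> y \<partial>st_base m)"

text \<open>The likelihood ratio of a parameter in \<open>params m\<close> has expectation 1 under
  the true law and so shows no decay in mean; the square root turns the one-step factor into an
  affinity. Factor \<open>s\<close> involves the reward at \<open>s\<close> and the state at
  \<open>Suc s\<close>, so \<open>root_lr \<gamma> t\<close> is a function of
  \<open>hist t\<close>.\<close>

definition root_lr :: "'p \<Rightarrow> nat \<Rightarrow> ('x, 'p, 'u) traj \<Rightarrow> real" where
  "root_lr \<gamma> t \<omega> = (\<Prod>s<t.
     sqrt (rdens \<gamma> (R_at s \<omega>) (X_at s \<omega>) (U_at s \<omega>) / rdens \<theta> (R_at s \<omega>) (X_at s \<omega>) (U_at s \<omega>)) *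
     sqrt (sdens \<gamma> (X_at (Suc s) \<omega>) (X_at s \<omega>) (U_at s \<omega>) / sdens \<theta> (X_at (Suc s) \<omega>) (X_at s \<omega>) (U_at s \<omega>)))"

sublocale M: prob_space M
  using law by (auto simp: thompson_law_def)

lemma base: "sigma_finite_measure (rew_base m)" "sigma_finite_measure (st_base m)"
  and sets_base: "sets (rew_base m) = sets \<R>" "sets (st_base m) = sets \<S>"
  using family by (auto simp: mdp_family_def)

sublocale rb: sigma_finite_measure "rew_base m" by (rule base)
sublocale sb: sigma_finite_measure "st_base m" by (rule base)

declare sets_base[measurable_cong]

lemma space_spaces: "space \<S> = states m" "space \<C> = controls m" "space \<R> = rewards m"
  by (auto simp: state_space_def control_space_def reward_space_def space_restrict_space)

lemma space_base: "space (rew_base m) = rewards m" "space (st_base m) = states m"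
  using sets_base[THEN sets_eq_imp_space_eq] by (auto simp: space_spaces)

lemma graph_sets[measurable]: "graph m \<in> sets (\<S> \<Otimes>\<^sub>M \<C>)"
  using family by (auto simp: mdp_family_def)

text \<open>The graph is a measurable subset of the product, and a function that is measurable on a
  measurable subset stays measurable when extended by 0.\<close>

lemma borel_measurable_extend_graph:
  fixes f :: "'b \<Rightarrow> 'x \<Rightarrow> 'u \<Rightarrow> real"
  assumes "(\<lambda>(z, x, u). f z x u) \<in> borel_measurable (N \<Otimes>\<^sub>M graph_space m)"
  shows "(\<lambda>(z, x, u). if (x, u) \<in> graph m then f z x u else 0) \<in> borel_measurable (N \<Otimes>\<^sub>M (\<S> \<Otimes>\<^sub>M \<C>))"
proof -
  let ?G = "space N \<times> graph m"
  have G[measurable]: "?G \<in> sets (N \<Otimes>\<^sub>M (\<S> \<Otimes>\<^sub>M \<C>))" by measurable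
  \<comment> \<open>Restricting the whole product or only its second factor: the identity is
    measurable from the first space to the second, as both components are.\<close>
  have "(\<lambda>z. z) \<in> restrict_space (N \<Otimes>\<^sub>M (\<S> \<Otimes>\<^sub>M \<C>)) ?G \<rightarrow>\<^sub>M N \<Otimes>\<^sub>M graph_space m"
    unfolding graph_space_def measurable_pair_iff comp_def
  proof (intro conjI measurable_restrict_space2)
    show "(\<lambda>z. snd z) \<in> space (restrict_space (N \<Otimes>\<^sub>M (\<S> \<Otimes>\<^sub>M \<C>)) ?G) \<rightarrow> graph m"
      by (auto simp: space_restrict_space)
  qed (rule measurable_restrict_space1, measurable)+
  from measurable_compose[OF this assms]
  have "(\<lambda>z. indicator ?G z *\<^sub>R (case z of (z, x, u) \<Rightarrow> f z x u)) \<in> borel_measurable (N \<Otimes>\<^sub>M (\<S> \<Otimes>\<^sub>M \<C>))"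
    by (subst (asm) borel_measurable_restrict_space_iff) (use G in auto)
  then show ?thesis
    by (rule measurable_cong[THEN iffD1, rotated]) (auto simp: space_pair_measure indicator_def split: if_splits)
qed

lemma measurable_rdens[measurable (raw)]:
  assumes "f \<in> N \<rightarrow>\<^sub>M \<R>" "g \<in> N \<rightarrow>\<^sub>M \<S>" "h \<in> N \<rightarrow>\<^sub>M \<C>"
  shows "(\<lambda>z. rdens \<gamma> (f z) (g z) (h z)) \<in> borel_measurable N"
proof (cases "\<gamma> \<in> params m")
  case True
  then have "(\<lambda>(r, x, u). rew_dens m \<gamma> r x u) \<in> borel_measurable (\<R> \<Otimes>\<^sub>M graph_space m)"
    using family by (auto simp: mdp_family_def)
  from measurable_compose[OF measurable_Pair[OF assms(1) measurable_Pair[OF assms(2,3)]] borel_measurable_extend_graph[OF this]]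
  show ?thesis using True by (simp add: rdens_def)
qed (simp add: rdens_def)

lemma measurable_sdens[measurable (raw)]:
  assumes "f \<in> N \<rightarrow>\<^sub>M \<S>" "g \<in> N \<rightarrow>\<^sub>M \<S>" "h \<in> N \<rightarrow>\<^sub>M \<C>"
  shows "(\<lambda>z. sdens \<gamma> (f z) (g z) (h z)) \<in> borel_measurable N"
proof (cases "\<gamma> \<in> params m")
  case True
  then have "(\<lambda>(y, x, u). st_dens m \<gamma> y x u) \<in> borel_measurable (\<S> \<Otimes>\<^sub>M graph_space m)"
    using family by (auto simp: mdp_family_def)
  from measurable_compose[OF measurable_Pair[OF assms(1) measurable_Pair[OF assms(2,3)]] borel_measurable_extend_graph[OF this]]
  show ?thesis using True by (simp add: sdens_def)
qed (simp add: sdens_def)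

lemma measurable_raff[measurable (raw)]:
  assumes [measurable]: "g \<in> N \<rightarrow>\<^sub>M \<S>" "h \<in> N \<rightarrow>\<^sub>M \<C>"
  shows "(\<lambda>z. raff \<gamma> (g z) (h z)) \<in> borel_measurable N"
  unfolding raff_def by measurable

lemma measurable_saff[measurable (raw)]:
  assumes [measurable]: "g \<in> N \<rightarrow>\<^sub>M \<S>" "h \<in> N \<rightarrow>\<^sub>M \<C>" "\<phi> \<in> borel_measurable \<S>"
  shows "(\<lambda>z. saff \<gamma> \<phi> (g z) (h z)) \<in> borel_measurable N"
  unfolding saff_def by measurable

section \<open>Bounds on the densities and the affinities\<close>

lemma dens_axioms:
  assumes "\<gamma> \<in> params m" "(x, u) \<in> graph m"
  shows "r \<in> rewards m \<Longrightarrow> 0 \<le> rew_dens m \<gamma> r x u" "y \<in> states m \<Longrightarrow> 0 \<le> st_dens m \<gamma> y x u"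
    "(\<integral>\<^sup>+ r. ennreal (rew_dens m \<gamma> r x u) \<partial>rew_base m) = 1"
    "(\<integral>\<^sup>+ y. ennreal (st_dens m \<gamma> y x u) \<partial>st_base m) = 1"
  using family assms unfolding mdp_family_def by blast+

lemma dens_nonneg:
  "r \<in> rewards m \<Longrightarrow> 0 \<le> rdens \<gamma> r x u" "y \<in> states m \<Longrightarrow> 0 \<le> sdens \<gamma> y x u"
  by (auto simp: rdens_def sdens_def dens_axioms)

lemma dens_integral:
  assumes "\<gamma> \<in> params m" "(x, u) \<in> graph m"
  shows "(\<integral>\<^sup>+ r. ennreal (rdens \<gamma> r x u) \<partial>rew_base m) = 1"
    "(\<integral>\<^sup>+ y. ennreal (sdens \<gamma> y x u) \<partial>st_base m) = 1"
  using assms by (auto simp: rdens_def sdens_def dens_axioms)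

lemma graph_in_space: "(x, u) \<in> graph m \<Longrightarrow> x \<in> space \<S> \<and> u \<in> space \<C>"
  using sets.sets_into_space[OF graph_sets] by (auto simp: space_pair_measure)

text \<open>The smaller of the two infima serves both densities. Nonnegativity of the densities
  makes the real infima genuine lower bounds.\<close>

lemma dens_lower_bound:
  assumes "\<gamma> \<in> params m"
  obtains c where "0 < c" "\<And>x u r. (x, u) \<in> graph m \<Longrightarrow> r \<in> rewards m \<Longrightarrow> c \<le> rdens \<gamma> r x u"
    "\<And>x u y. (x, u) \<in> graph m \<Longrightarrow> y \<in> states m \<Longrightarrow> c \<le> sdens \<gamma> y x u"
proof -
  let ?a = "INF ((x, u), r)\<in>graph m \<times> rewards m. rew_dens m \<gamma> r x u"
  let ?b = "INF ((x, u), y)\<in>graph m \<times> states m. st_dens m \<gamma> y x u"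
  note nn = dens_axioms(1,2)[OF assms]
  have a: "?a \<le> rew_dens m \<gamma> r x u" if "(x, u) \<in> graph m" "r \<in> rewards m" for x u r
    using cINF_lower[OF bdd_belowI2[where m=0 and f="\<lambda>((x, u), r). rew_dens m \<gamma> r x u"], of "graph m \<times> rewards m" "((x, u), r)"] that nn
    by (auto simp: split_beta)
  have b: "?b \<le> st_dens m \<gamma> y x u" if "(x, u) \<in> graph m" "y \<in> states m" for x u y
    using cINF_lower[OF bdd_belowI2[where m=0 and f="\<lambda>((x, u), y). st_dens m \<gamma> y x u"], of "graph m \<times> states m" "((x, u), y)"] that nn
    by (auto simp: split_beta)
  have "?a > 0" "?b > 0" using lower assms by (auto simp: densities_bounded_below_def)
  then show thesis
    using a b assms by (intro that[of "min ?a ?b"]) (auto simp: rdens_def sdens_def min_le_iff_disj)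
qed

lemma dens_pos:
  assumes "\<gamma> \<in> params m" "(x, u) \<in> graph m"
  shows "r \<in> rewards m \<Longrightarrow> 0 < rdens \<gamma> r x u" "y \<in> states m \<Longrightarrow> 0 < sdens \<gamma> y x u"
proof -
  obtain c where c: "0 < c" "\<And>r. r \<in> rewards m \<Longrightarrow> c \<le> rdens \<gamma> r x u" "\<And>y. y \<in> states m \<Longrightarrow> c \<le> sdens \<gamma> y x u"
    using dens_lower_bound[OF assms(1)] assms(2) by metis
  show "0 < rdens \<gamma> r x u" if "r \<in> rewards m" using c(1) c(2)[OF that] by simp
  show "0 < sdens \<gamma> y x u" if "y \<in> states m" using c(1) c(3)[OF that] by simp
qed

lemma aff_le_1:
  assumes "\<gamma> \<in> params m" "(x, u) \<in> graph m"
  shows "raff \<gamma> x u \<le> 1" "saff \<gamma> (\<lambda>_. 1) x u \<le> 1"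
proof -
  have [simp]: "x \<in> space \<S>" "u \<in> space \<C>" using graph_in_space[OF assms(2)] by auto
  note [simp] = assms true_param dens_integral dens_nonneg space_base
  show "raff \<gamma> x u \<le> 1"
    unfolding raff_def by (rule nn_integral_sqrt_mult_le_1) simp_all
  show "saff \<gamma> (\<lambda>_. 1) x u \<le> 1"
    unfolding saff_def mult_1_right by (rule nn_integral_sqrt_mult_le_1) simp_all
qed

text \<open>An affinity of 1 would make both pairs of densities agree almost everywhere, hence the
  joint laws coincide, with relative entropy 0; this contradicts the positive infimum. The bound is
  strict at each point but not uniform over the graph.\<close>

lemma aff_less_1:
  assumes "\<gamma> \<in> params m" "\<gamma> \<noteq> \<theta>" "(x, u) \<in> graph m" "entropy_separated m \<theta>"
  shows "raff \<gamma> x u * saff \<gamma> (\<lambda>_. 1) x u < 1"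
proof (rule ccontr)
  assume "\<not> ?thesis"
  then have ge: "1 \<le> raff \<gamma> x u * saff \<gamma> (\<lambda>_. 1) x u" by simp
  note le = aff_le_1[OF assms(1,3)]
  \<comment> \<open>Two factors that are at most 1 and have a product of at least 1 are both equal
    to 1.\<close>
  have "raff \<gamma> x u * saff \<gamma> (\<lambda>_. 1) x u \<le> raff \<gamma> x u * 1" "raff \<gamma> x u * saff \<gamma> (\<lambda>_. 1) x u \<le> 1 * saff \<gamma> (\<lambda>_. 1) x u"
    using le by (intro mult_mono; simp)+
  from order_trans[OF ge this(1)] order_trans[OF ge this(2)] le
  have eq: "raff \<gamma> x u = 1" "saff \<gamma> (\<lambda>_. 1) x u = 1" by (auto intro!: antisym)
  have [simp]: "x \<in> space \<S>" "u \<in> space \<C>" using graph_in_space[OF assms(3)] by auto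
  note [simp] = assms(1,3) true_param dens_integral dens_nonneg space_base
  have ae1: "AE r in rew_base m. rdens \<theta> r x u = rdens \<gamma> r x u"
    using eq(1) unfolding raff_def
    by (rule nn_integral_sqrt_mult_eq_1D[rotated -1]) simp_all
  have ae2: "AE y in st_base m. sdens \<theta> y x u = sdens \<gamma> y x u"
    using eq(2) unfolding saff_def mult_1_right
    by (rule nn_integral_sqrt_mult_eq_1D[rotated -1]) simp_all
  interpret P: pair_sigma_finite "rew_base m" "st_base m" ..
  have joint: "joint_law m \<delta> x u = density (rew_base m \<Otimes>\<^sub>M st_base m) (\<lambda>(r, y). ennreal (rdens \<delta> r x u * sdens \<delta> y x u))"
    if "\<delta> \<in> params m" for \<delta>
    using that assms(3) by (simp add: joint_law_def rdens_def sdens_def)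
  have "joint_law m \<theta> x u = joint_law m \<gamma> x u"
    unfolding joint[OF true_param] joint[OF assms(1)]
  proof (rule density_cong)
    have "AE z in rew_base m \<Otimes>\<^sub>M st_base m. rdens \<theta> (fst z) x u = rdens \<gamma> (fst z) x u \<and> sdens \<theta> (snd z) x u = sdens \<gamma> (snd z) x u"
      using ae1 ae2 by (intro P.AE_pair_measure) auto
    then show "AE z in rew_base m \<Otimes>\<^sub>M st_base m. (case z of (r, y) \<Rightarrow> ennreal (rdens \<theta> r x u * sdens \<theta> y x u)) =
        (case z of (r, y) \<Rightarrow> ennreal (rdens \<gamma> r x u * sdens \<gamma> y x u))"
      by eventually_elim (auto simp: split_beta)
  qed measurable
  \<comment> \<open>The densities are real-valued, so the joint law is sigma-finite, as the
    vanishing of its relative entropy to itself requires.\<close>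
  moreover have "sigma_finite_measure (joint_law m \<gamma> x u)"
    unfolding joint[OF assms(1)]
    by (subst P.sigma_finite_iff_density_finite) auto
  ultimately have "rel_entropy (joint_law m \<theta> x u) (joint_law m \<gamma> x u) = 0"
    by (simp add: sigma_finite_measure.rel_entropy_same)
  moreover have "(INF (x, u)\<in>graph m. rel_entropy (joint_law m \<theta> x u) (joint_law m \<gamma> x u)) > 0"
    using assms by (auto simp: entropy_separated_def)
  moreover have "(INF (x, u)\<in>graph m. rel_entropy (joint_law m \<theta> x u) (joint_law m \<gamma> x u))
      \<le> rel_entropy (joint_law m \<theta> x u) (joint_law m \<gamma> x u)"
    by (rule INF_lower2[OF assms(3)]) simp
  ultimately show False by simp
qed

section \<open>Measurability and admissibility along the process\<close>

lemma cond_laws: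
  "has_cond_law M (hist_space m t) (hist t) (count_space (params m)) (Theta_at t)
     (\<lambda>\<omega>. point_measure (params m) (\<lambda>\<gamma>. ennreal (posterior m prior \<gamma> t \<omega>)))"
  "AE \<omega> in M. U_at t \<omega> = \<mu> (Theta_at t \<omega>) (X_at t \<omega>)"
  "has_cond_law M (hist_space m t \<Otimes>\<^sub>M (count_space (params m) \<Otimes>\<^sub>M \<C>))
     (\<lambda>\<omega>. (hist t \<omega>, Theta_at t \<omega>, U_at t \<omega>)) \<R> (R_at t)
     (\<lambda>\<omega>. reward_law m \<theta> (X_at t \<omega>) (U_at t \<omega>))"
  "has_cond_law M (hist_space m t \<Otimes>\<^sub>M (count_space (params m) \<Otimes>\<^sub>M (\<C> \<Otimes>\<^sub>M \<R>)))
     (\<lambda>\<omega>. (hist t \<omega>, Theta_at t \<omega>, U_at t \<omega>, R_at t \<omega>)) \<S> (X_at (Suc t))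
     (\<lambda>\<omega>. transition_law m \<theta> (X_at t \<omega>) (U_at t \<omega>))"
  using law unfolding thompson_law_def by auto

text \<open>Stated for an arbitrary \<open>F\<close> because it is applied both to \<open>M\<close>
  and to the smaller sigma-algebras on which one conditions.\<close>

lemma hist_components:
  assumes "hist t \<in> F \<rightarrow>\<^sub>M hist_space m t"
  shows "X_at t \<in> F \<rightarrow>\<^sub>M \<S>" "s < t \<Longrightarrow> X_at s \<in> F \<rightarrow>\<^sub>M \<S>"
    "s < t \<Longrightarrow> U_at s \<in> F \<rightarrow>\<^sub>M \<C>" "s < t \<Longrightarrow> R_at s \<in> F \<rightarrow>\<^sub>M \<R>"
proof -
  have *: "(\<lambda>\<omega>. fst (hist t \<omega>)) \<in> F \<rightarrow>\<^sub>M (\<Pi>\<^sub>M s\<in>{..<t}. step_space m)"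
    "(\<lambda>\<omega>. snd (hist t \<omega>)) \<in> F \<rightarrow>\<^sub>M \<S>"
    using assms unfolding hist_space_def measurable_pair_iff by (auto simp: comp_def)
  then show "X_at t \<in> F \<rightarrow>\<^sub>M \<S>" by (simp add: hist_def)
  have [measurable]: "(\<lambda>\<omega>. \<omega> s) \<in> F \<rightarrow>\<^sub>M \<S> \<Otimes>\<^sub>M (count_space (params m) \<Otimes>\<^sub>M (\<C> \<Otimes>\<^sub>M \<R>))" if "s < t"
    using measurable_compose[OF *(1) measurable_component_singleton[of s]] that
    by (simp add: hist_def step_space_def)
  show "X_at s \<in> F \<rightarrow>\<^sub>M \<S>" if [simp]: "s < t"
    unfolding X_at_def[abs_def] by measurable
  show "U_at s \<in> F \<rightarrow>\<^sub>M \<C>" if [simp]: "s < t"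
    unfolding U_at_def[abs_def] by measurable
  show "R_at s \<in> F \<rightarrow>\<^sub>M \<R>" if [simp]: "s < t"
    unfolding R_at_def[abs_def] by measurable
qed

lemma root_lr_measurable:
  assumes H: "hist t \<in> F \<rightarrow>\<^sub>M hist_space m t"
  shows "root_lr \<gamma> t \<in> borel_measurable F"
  unfolding root_lr_def[abs_def]
proof (rule borel_measurable_prod)
  fix s assume "s \<in> {..<t}"
  then have "s < t" by simp
  note [measurable] = hist_components(2-4)[OF H this]
  \<comment> \<open>The state following the last complete tuple is the separate second component of
    the history.\<close>
  have [measurable]: "X_at (Suc s) \<in> F \<rightarrow>\<^sub>M \<S>"
    using hist_components(1,2)[OF H] \<open>s < t\<close> by (cases "Suc s = t") auto
  show "(\<lambda>\<omega>.
     sqrt (rdens \<gamma> (R_at s \<omega>) (X_at s \<omega>) (U_at s \<omega>) / rdens \<theta> (R_at s \<omega>) (X_at s \<omega>) (U_at s \<omega>)) *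
     sqrt (sdens \<gamma> (X_at (Suc s) \<omega>) (X_at s \<omega>) (U_at s \<omega>) / sdens \<theta> (X_at (Suc s) \<omega>) (X_at s \<omega>) (U_at s \<omega>)))
     \<in> borel_measurable F"
    by measurable
qed

lemma measurable_hist: "hist t \<in> M \<rightarrow>\<^sub>M hist_space m t"
  using cond_laws(1) by (auto simp: has_cond_law_def)

lemma measurable_X_at[measurable]: "X_at t \<in> M \<rightarrow>\<^sub>M \<S>"
  and measurable_U_at[measurable]: "U_at t \<in> M \<rightarrow>\<^sub>M \<C>"
  and measurable_R_at[measurable]: "R_at t \<in> M \<rightarrow>\<^sub>M \<R>"
  and measurable_root_lr[measurable]: "root_lr \<gamma> t \<in> borel_measurable M"
  using hist_components(2-4)[OF measurable_hist lessI] root_lr_measurable[OF measurable_hist] by auto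

text \<open>\<open>Theta_at t\<close> takes its values in \<open>params m\<close>, so the control is
  always the one chosen by one of finitely many policies. This finiteness is what makes the affinity
  uniformly small on a set of states.\<close>

lemma AE_admissible:
  "AE \<omega> in M. (X_at t \<omega>, U_at t \<omega>) \<in> graph m \<and> (\<exists>\<gamma>\<in>params m. U_at t \<omega> = \<mu> \<gamma> (X_at t \<omega>))"
  using cond_laws(2)[of t] AE_space
proof eventually_elim
  case (elim \<omega>)
  have "Theta_at t \<omega> \<in> params m"
    using cond_laws(1)[of t] elim(2) measurable_space[of "Theta_at t" M "count_space (params m)" \<omega>]
    by (simp add: has_cond_law_def)
  moreover have "X_at t \<omega> \<in> states m"
    using measurable_space[OF measurable_X_at elim(2)] by (simp add: space_spaces)
  ultimately show ?case
    using elim(1) policies by (auto simp: optimal_policies_def graph_def)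
qed

lemma true_kernels:
  assumes "(x, u) \<in> graph m"
  shows "prob_space (reward_law m \<theta> x u) \<and>
      reward_law m \<theta> x u = density (rew_base m) (\<lambda>r. ennreal (rdens \<theta> r x u))"
    "prob_space (transition_law m \<theta> x u) \<and>
      transition_law m \<theta> x u = density (st_base m) (\<lambda>y. ennreal (sdens \<theta> y x u))"
proof -
  have [simp]: "x \<in> space \<S>" "u \<in> space \<C>" using graph_in_space[OF assms] by auto
  have eq: "reward_law m \<theta> x u = density (rew_base m) (\<lambda>r. ennreal (rdens \<theta> r x u))"
    "transition_law m \<theta> x u = density (st_base m) (\<lambda>y. ennreal (sdens \<theta> y x u))"
    using assms true_param by (simp_all add: reward_law_def transition_law_def rdens_def sdens_def)
  show "prob_space (reward_law m \<theta> x u) \<and>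
      reward_law m \<theta> x u = density (rew_base m) (\<lambda>r. ennreal (rdens \<theta> r x u))"
    using dens_integral(1)[OF true_param assms] unfolding eq(1)
    by (auto intro!: prob_spaceI simp: emeasure_density cong: nn_integral_cong)
  show "prob_space (transition_law m \<theta> x u) \<and>
      transition_law m \<theta> x u = density (st_base m) (\<lambda>y. ennreal (sdens \<theta> y x u))"
    using dens_integral(2)[OF true_param assms] unfolding eq(2)
    by (auto intro!: prob_spaceI simp: emeasure_density cong: nn_integral_cong)
qed

lemma root_lr_nonneg: "0 \<le> root_lr \<gamma> t \<omega>" if "\<omega> \<in> space M"
  using measurable_space[OF measurable_X_at that] measurable_space[OF measurable_R_at that]
  unfolding root_lr_def by (intro prod_nonneg) (auto simp: dens_nonneg space_spaces)

section \<open>The one-step recursion for the expected root of the likelihood ratio\<close>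

text \<open>Two conditionings in succession: first the next state is integrated out given everything
  up to the reward, then the reward given everything up to the control. Each turns a root ratio into
  an affinity. The weight \<open>\<phi>\<close> on the next state allows two steps to be
  combined.\<close>

lemma nn_integral_root_lr_Suc:
  assumes [measurable]: "\<phi> \<in> borel_measurable \<S>"
  shows "(\<integral>\<^sup>+ \<omega>. ennreal (root_lr \<gamma> (Suc t) \<omega>) * \<phi> (X_at (Suc t) \<omega>) \<partial>M)
    = (\<integral>\<^sup>+ \<omega>. ennreal (root_lr \<gamma> t \<omega>) *
        (raff \<gamma> (X_at t \<omega>) (U_at t \<omega>) * saff \<gamma> \<phi> (X_at t \<omega>) (U_at t \<omega>)) \<partial>M)"
proof -
  let ?X = "X_at t" and ?U = "U_at t"
  let ?a = "\<lambda>r \<omega>. sqrt (rdens \<gamma> r (?X \<omega>) (?U \<omega>) / rdens \<theta> r (?X \<omega>) (?U \<omega>))"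
  let ?b = "\<lambda>y \<omega>. sqrt (sdens \<gamma> y (?X \<omega>) (?U \<omega>) / sdens \<theta> y (?X \<omega>) (?U \<omega>))"
  have nn: "0 \<le> ?a r \<omega>" "0 \<le> ?b y \<omega>" if "r \<in> rewards m" "y \<in> states m" for r y \<omega>
    using that by (simp_all add: dens_nonneg)
  have sp: "?X \<omega> \<in> space \<S>" "?U \<omega> \<in> space \<C>" "R_at t \<omega> \<in> rewards m" "X_at (Suc t) \<omega> \<in> states m"
    if "\<omega> \<in> space M" for \<omega>
    using measurable_space[OF measurable_X_at[of t] that] measurable_space[OF measurable_X_at[of "Suc t"] that]
      measurable_space[OF measurable_U_at that]
      measurable_space[OF measurable_R_at that] by (simp_all add: space_spaces)
  define V3 where "V3 = (\<lambda>\<omega> :: ('x, 'p, 'u) traj. (hist t \<omega>, Theta_at t \<omega>, U_at t \<omega>, R_at t \<omega>))"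
  define N3 where "N3 = hist_space m t \<Otimes>\<^sub>M (count_space (params m) \<Otimes>\<^sub>M (\<C> \<Otimes>\<^sub>M \<R>))"
  \<comment> \<open>\<open>F3\<close> is the information available just before the next state is
    drawn, and \<open>F2\<close> below that just before the reward is drawn.\<close>
  define F3 where "F3 = vimage_algebra (space M) V3 N3"
  define V2 where "V2 = (\<lambda>\<omega> :: ('x, 'p, 'u) traj. (hist t \<omega>, Theta_at t \<omega>, U_at t \<omega>))"
  define N2 where "N2 = hist_space m t \<Otimes>\<^sub>M (count_space (params m) \<Otimes>\<^sub>M \<C>)"
  define F2 where "F2 = vimage_algebra (space M) V2 N2"
  note law3 = cond_laws(4)[of t, folded V3_def N3_def]
  note law2 = cond_laws(3)[of t, folded V2_def N2_def]
  have "V3 \<in> F3 \<rightarrow>\<^sub>M N3" "V2 \<in> F2 \<rightarrow>\<^sub>M N2"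
    using law3 law2 unfolding F3_def F2_def has_cond_law_def
    by (auto intro!: measurable_vimage_algebra1 dest: measurable_space)
  then have H3: "hist t \<in> F3 \<rightarrow>\<^sub>M hist_space m t" and U3[measurable]: "U_at t \<in> F3 \<rightarrow>\<^sub>M \<C>" "R_at t \<in> F3 \<rightarrow>\<^sub>M \<R>"
    and H2: "hist t \<in> F2 \<rightarrow>\<^sub>M hist_space m t" and U2[measurable]: "U_at t \<in> F2 \<rightarrow>\<^sub>M \<C>"
    unfolding V3_def N3_def V2_def N2_def measurable_pair_iff by (simp_all add: comp_def)
  note [measurable] = hist_components(1)[OF H3] hist_components(1)[OF H2]
    root_lr_measurable[OF H3] root_lr_measurable[OF H2]
  have "(\<integral>\<^sup>+ \<omega>. ennreal (root_lr \<gamma> (Suc t) \<omega>) * \<phi> (X_at (Suc t) \<omega>) \<partial>M) =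
    (\<integral>\<^sup>+ \<omega>. (\<lambda>(\<omega>, y). ennreal (root_lr \<gamma> t \<omega>) * ennreal (?a (R_at t \<omega>) \<omega>) * (ennreal (?b y \<omega>) * \<phi> y)) (\<omega>, X_at (Suc t) \<omega>) \<partial>M)"
  proof (rule nn_integral_cong)
    fix \<omega> assume "\<omega> \<in> space M"
    have "root_lr \<gamma> (Suc t) \<omega> = root_lr \<gamma> t \<omega> * (?a (R_at t \<omega>) \<omega> * ?b (X_at (Suc t) \<omega>) \<omega>)"
      by (simp add: root_lr_def)
    moreover have "ennreal \<dots> = ennreal (root_lr \<gamma> t \<omega>) * (ennreal (?a (R_at t \<omega>) \<omega>) * ennreal (?b (X_at (Suc t) \<omega>) \<omega>))"
      by (simp only: ennreal_mult'[OF root_lr_nonneg[OF \<open>\<omega> \<in> space M\<close>]]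
        ennreal_mult'[OF nn(1)[OF sp(3,4)[OF \<open>\<omega> \<in> space M\<close>], of \<omega>]])
    ultimately show "ennreal (root_lr \<gamma> (Suc t) \<omega>) * \<phi> (X_at (Suc t) \<omega>) =
        (\<lambda>(\<omega>, y). ennreal (root_lr \<gamma> t \<omega>) * ennreal (?a (R_at t \<omega>) \<omega>) * (ennreal (?b y \<omega>) * \<phi> y)) (\<omega>, X_at (Suc t) \<omega>)"
      by (simp add: mult.assoc)
  qed
  \<comment> \<open>The next state is integrated out. Its law has the density
    \<open>sdens \<theta>\<close> only on the graph, where the process stays almost surely.\<close>
  also have "\<dots> = (\<integral>\<^sup>+ \<omega>. \<integral>\<^sup>+ y. (\<lambda>(\<omega>, y). ennreal (sdens \<theta> y (?X \<omega>) (?U \<omega>))) (\<omega>, y) *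
      (\<lambda>(\<omega>, y). ennreal (root_lr \<gamma> t \<omega>) * ennreal (?a (R_at t \<omega>) \<omega>) * (ennreal (?b y \<omega>) * \<phi> y)) (\<omega>, y) \<partial>st_base m \<partial>M)"
  proof (rule nn_integral_cond_law_density[OF M.prob_space_axioms law3 sets_base(2) base(2)])
    show "AE \<omega> in M. prob_space (transition_law m \<theta> (?X \<omega>) (?U \<omega>)) \<and>
        transition_law m \<theta> (?X \<omega>) (?U \<omega>) = density (st_base m) (\<lambda>y. (\<lambda>(\<omega>, y). ennreal (sdens \<theta> y (?X \<omega>) (?U \<omega>))) (\<omega>, y))"
      using AE_admissible by eventually_elim (use true_kernels in auto)
  qed (fold F3_def, measurable)
  also have "\<dots> = (\<integral>\<^sup>+ \<omega>. (\<lambda>(\<omega>, r). ennreal (root_lr \<gamma> t \<omega>) * saff \<gamma> \<phi> (?X \<omega>) (?U \<omega>) * ennreal (?a r \<omega>)) (\<omega>, R_at t \<omega>) \<partial>M)"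
  proof (rule nn_integral_cong)
    fix \<omega> assume \<omega>: "\<omega> \<in> space M"
    note [simp] = sp[OF \<omega>]
    have "(\<integral>\<^sup>+ y. ennreal (sdens \<theta> y (?X \<omega>) (?U \<omega>)) * (ennreal (root_lr \<gamma> t \<omega>) * ennreal (?a (R_at t \<omega>) \<omega>) * (ennreal (?b y \<omega>) * \<phi> y)) \<partial>st_base m)
      = (\<integral>\<^sup>+ y. (ennreal (root_lr \<gamma> t \<omega>) * ennreal (?a (R_at t \<omega>) \<omega>)) * (ennreal (sqrt (sdens \<theta> y (?X \<omega>) (?U \<omega>) * sdens \<gamma> y (?X \<omega>) (?U \<omega>))) * \<phi> y) \<partial>st_base m)"
    proof (rule nn_integral_cong)
      fix y assume "y \<in> space (st_base m)"
      then have "0 \<le> sdens \<delta> y (?X \<omega>) (?U \<omega>)" for \<delta> by (simp add: dens_nonneg space_base)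
      then have eq: "ennreal (sdens \<theta> y (?X \<omega>) (?U \<omega>)) * ennreal (?b y \<omega>) = ennreal (sqrt (sdens \<theta> y (?X \<omega>) (?U \<omega>) * sdens \<gamma> y (?X \<omega>) (?U \<omega>)))"
        by (simp add: real_mult_sqrt_divide flip: ennreal_mult)
      show "ennreal (sdens \<theta> y (?X \<omega>) (?U \<omega>)) * (ennreal (root_lr \<gamma> t \<omega>) * ennreal (?a (R_at t \<omega>) \<omega>) * (ennreal (?b y \<omega>) * \<phi> y))
        = (ennreal (root_lr \<gamma> t \<omega>) * ennreal (?a (R_at t \<omega>) \<omega>)) * (ennreal (sqrt (sdens \<theta> y (?X \<omega>) (?U \<omega>) * sdens \<gamma> y (?X \<omega>) (?U \<omega>))) * \<phi> y)"
        unfolding eq[symmetric] by (simp only: ac_simps)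
    qed
    also have "\<dots> = ennreal (root_lr \<gamma> t \<omega>) * ennreal (?a (R_at t \<omega>) \<omega>) * saff \<gamma> \<phi> (?X \<omega>) (?U \<omega>)"
      unfolding saff_def by (rule nn_integral_cmult) measurable
    finally show "(\<integral>\<^sup>+ y. (\<lambda>(\<omega>, y). ennreal (sdens \<theta> y (?X \<omega>) (?U \<omega>))) (\<omega>, y) *
      (\<lambda>(\<omega>, y). ennreal (root_lr \<gamma> t \<omega>) * ennreal (?a (R_at t \<omega>) \<omega>) * (ennreal (?b y \<omega>) * \<phi> y)) (\<omega>, y) \<partial>st_base m)
      = (\<lambda>(\<omega>, r). ennreal (root_lr \<gamma> t \<omega>) * saff \<gamma> \<phi> (?X \<omega>) (?U \<omega>) * ennreal (?a r \<omega>)) (\<omega>, R_at t \<omega>)"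
      by (simp add: ac_simps)
  qed
  \<comment> \<open>The reward is integrated out. The factor \<open>saff\<close> depends on the
    current state and control only and is therefore measurable with respect to
    \<open>F2\<close>.\<close>
  also have "\<dots> = (\<integral>\<^sup>+ \<omega>. \<integral>\<^sup>+ r. (\<lambda>(\<omega>, r). ennreal (rdens \<theta> r (?X \<omega>) (?U \<omega>))) (\<omega>, r) *
      (\<lambda>(\<omega>, r). ennreal (root_lr \<gamma> t \<omega>) * saff \<gamma> \<phi> (?X \<omega>) (?U \<omega>) * ennreal (?a r \<omega>)) (\<omega>, r) \<partial>rew_base m \<partial>M)"
  proof (rule nn_integral_cond_law_density[OF M.prob_space_axioms law2 sets_base(1) base(1)])
    show "AE \<omega> in M. prob_space (reward_law m \<theta> (?X \<omega>) (?U \<omega>)) \<and>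
        reward_law m \<theta> (?X \<omega>) (?U \<omega>) = density (rew_base m) (\<lambda>r. (\<lambda>(\<omega>, r). ennreal (rdens \<theta> r (?X \<omega>) (?U \<omega>))) (\<omega>, r))"
      using AE_admissible by eventually_elim (use true_kernels in auto)
  qed (fold F2_def, measurable)
  also have "\<dots> = (\<integral>\<^sup>+ \<omega>. ennreal (root_lr \<gamma> t \<omega>) * (raff \<gamma> (?X \<omega>) (?U \<omega>) * saff \<gamma> \<phi> (?X \<omega>) (?U \<omega>)) \<partial>M)"
  proof (rule nn_integral_cong)
    fix \<omega> assume \<omega>: "\<omega> \<in> space M"
    note [simp] = sp[OF \<omega>]
    let ?K = "ennreal (root_lr \<gamma> t \<omega>) * saff \<gamma> \<phi> (?X \<omega>) (?U \<omega>)"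
    have "(\<integral>\<^sup>+ r. ennreal (rdens \<theta> r (?X \<omega>) (?U \<omega>)) * (?K * ennreal (?a r \<omega>)) \<partial>rew_base m)
      = (\<integral>\<^sup>+ r. ?K * ennreal (sqrt (rdens \<theta> r (?X \<omega>) (?U \<omega>) * rdens \<gamma> r (?X \<omega>) (?U \<omega>))) \<partial>rew_base m)"
    proof (rule nn_integral_cong)
      fix r assume "r \<in> space (rew_base m)"
      then have "0 \<le> rdens \<delta> r (?X \<omega>) (?U \<omega>)" for \<delta> by (simp add: dens_nonneg space_base)
      then have eq: "ennreal (rdens \<theta> r (?X \<omega>) (?U \<omega>)) * ennreal (?a r \<omega>) = ennreal (sqrt (rdens \<theta> r (?X \<omega>) (?U \<omega>) * rdens \<gamma> r (?X \<omega>) (?U \<omega>)))"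
        by (simp add: real_mult_sqrt_divide flip: ennreal_mult)
      show "ennreal (rdens \<theta> r (?X \<omega>) (?U \<omega>)) * (?K * ennreal (?a r \<omega>)) = ?K * ennreal (sqrt (rdens \<theta> r (?X \<omega>) (?U \<omega>) * rdens \<gamma> r (?X \<omega>) (?U \<omega>)))"
        unfolding eq[symmetric] by (simp only: ac_simps)
    qed
    also have "\<dots> = ?K * raff \<gamma> (?X \<omega>) (?U \<omega>)"
      unfolding raff_def by (rule nn_integral_cmult) measurable
    finally show "(\<integral>\<^sup>+ r. (\<lambda>(\<omega>, r). ennreal (rdens \<theta> r (?X \<omega>) (?U \<omega>))) (\<omega>, r) *
      (\<lambda>(\<omega>, r). ennreal (root_lr \<gamma> t \<omega>) * saff \<gamma> \<phi> (?X \<omega>) (?U \<omega>) * ennreal (?a r \<omega>)) (\<omega>, r) \<partial>rew_base m)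
      = ennreal (root_lr \<gamma> t \<omega>) * (raff \<gamma> (?X \<omega>) (?U \<omega>) * saff \<gamma> \<phi> (?X \<omega>) (?U \<omega>))"
      by (simp add: ac_simps)
  qed
  finally show ?thesis .
qed

section \<open>Distinguishing states and the two-step contraction\<close>

lemma policy_measurable: "\<gamma> \<in> params m \<Longrightarrow> \<mu> \<gamma> \<in> \<S> \<rightarrow>\<^sub>M \<C>"
  and policy_graph: "\<gamma> \<in> params m \<Longrightarrow> x \<in> states m \<Longrightarrow> (x, \<mu> \<gamma> x) \<in> graph m"
  using policies by (auto simp: optimal_policies_def graph_def)

text \<open>Since the affinity is below 1 everywhere and there are finitely many policies, the sets
  on which all affinities are at most \<open>1 - 1 / real (Suc n)\<close> cover the state space. The
  reference measure is not zero, so one of them has positive measure.\<close>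

lemma distinguishing_states:
  assumes \<gamma>: "\<gamma> \<in> params m" "\<gamma> \<noteq> \<theta>" and sep: "entropy_separated m \<theta>" and x0: "x0 \<in> states m"
  obtains A \<kappa> where "A \<in> sets \<S>" "emeasure (st_base m) A > 0" "0 < \<kappa>" "\<kappa> \<le> 1"
    "\<And>x \<delta>. x \<in> A \<Longrightarrow> \<delta> \<in> params m \<Longrightarrow> raff \<gamma> x (\<mu> \<delta> x) * saff \<gamma> (\<lambda>_. 1) x (\<mu> \<delta> x) \<le> ennreal (1 - \<kappa>)"
proof -
  have fin: "finite (params m)" using family by (simp add: mdp_family_def)
  define B where "B \<delta> x = raff \<gamma> x (\<mu> \<delta> x) * saff \<gamma> (\<lambda>_. 1) x (\<mu> \<delta> x)" for \<delta> x
  define A where "A n = {x \<in> space \<S>. \<forall>\<delta>\<in>params m. B \<delta> x \<le> ennreal (1 - 1 / real (Suc n))}" for n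
  have A_sets: "A n \<in> sets \<S>" for n
  proof -
    have [measurable]: "B \<delta> \<in> borel_measurable \<S>" if "\<delta> \<in> params m" for \<delta>
      unfolding B_def using policy_measurable[OF that] by measurable
    have "A n = space \<S> \<inter> (\<Inter>\<delta>\<in>params m. {x \<in> space \<S>. B \<delta> x \<le> ennreal (1 - 1 / real (Suc n))})"
      by (auto simp: A_def)
    also have "\<dots> \<in> sets \<S>"
      using fin true_param by (intro sets.Int sets.top sets.finite_INT) auto
    finally show ?thesis .
  qed
  have union: "(\<Union>n. A n) = space (st_base m)"
  proof safe
    fix x assume x: "x \<in> space (st_base m)"
    have lim: "(\<lambda>n. ennreal (1 - 1 / real (Suc n))) \<longlonglongrightarrow> ennreal (1 - 0)"
      by (intro tendsto_ennrealI tendsto_diff tendsto_const LIMSEQ_Suc[OF lim_1_over_n])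
    \<comment> \<open>The thresholds tend to 1, and each of the finitely many affinities at
      \<open>x\<close> is eventually below them.\<close>
    have "\<forall>\<^sub>F n in sequentially. \<forall>\<delta>\<in>params m. B \<delta> x < ennreal (1 - 1 / real (Suc n))"
      using fin
    proof (intro eventually_ball_finite ballI)
      fix \<delta> assume "\<delta> \<in> params m"
      then have "B \<delta> x < ennreal (1 - 0)"
        using aff_less_1[OF \<gamma> policy_graph sep] x by (simp add: B_def space_base)
      then show "\<forall>\<^sub>F n in sequentially. B \<delta> x < ennreal (1 - 1 / real (Suc n))"
        using order_tendstoD(1)[OF lim] by blast
    qed
    then obtain n where "\<forall>\<delta>\<in>params m. B \<delta> x < ennreal (1 - 1 / real (Suc n))"
      by (auto simp: eventually_sequentially)
    then show "x \<in> (\<Union>n. A n)"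
      using x by (auto simp: A_def space_base space_spaces intro: less_imp_le)
  qed (auto simp: A_def space_base space_spaces)
  have "\<exists>n. emeasure (st_base m) (A n) \<noteq> 0"
  proof (rule ccontr)
    assume "\<not> ?thesis"
    then have "emeasure (st_base m) (\<Union>n. A n) = 0"
      using A_sets by (intro emeasure_UN_eq_0) (auto simp: sets_base)
    then have "space (st_base m) \<in> null_sets (st_base m)"
      by (simp add: union null_sets_def)
    \<comment> \<open>A zero reference measure could not carry the transition density at
      \<open>x0\<close>, which integrates to 1.\<close>
    then have "AE y in st_base m. False"
      unfolding eventually_ae_filter by auto
    then have "(\<integral>\<^sup>+ y. ennreal (sdens \<theta> y x0 (\<mu> \<theta> x0)) \<partial>st_base m) = (\<integral>\<^sup>+ y. 0 \<partial>st_base m)"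
      by (intro nn_integral_cong_AE) auto
    then show False
      using dens_integral(2)[OF true_param policy_graph[OF true_param x0]] by simp
  qed
  then obtain n where "emeasure (st_base m) (A n) > 0" by (auto simp: zero_less_iff_neq_zero)
  then show thesis
    using A_sets by (intro that[of "A n" "1 / real (Suc n)"]) (auto simp: A_def B_def)
qed

text \<open>The recursion with weight 1, together with affinities of at most 1. It supplies the
  starting bound at time 1 for the odd times.\<close>

lemma nn_integral_root_lr_Suc_le:
  assumes "\<gamma> \<in> params m"
  shows "(\<integral>\<^sup>+ \<omega>. ennreal (root_lr \<gamma> (Suc t) \<omega>) \<partial>M) \<le> (\<integral>\<^sup>+ \<omega>. ennreal (root_lr \<gamma> t \<omega>) \<partial>M)"
proof -
  have "(\<integral>\<^sup>+ \<omega>. ennreal (root_lr \<gamma> (Suc t) \<omega>) \<partial>M) = (\<integral>\<^sup>+ \<omega>. ennreal (root_lr \<gamma> t \<omega>) *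
        (raff \<gamma> (X_at t \<omega>) (U_at t \<omega>) * saff \<gamma> (\<lambda>_. 1) (X_at t \<omega>) (U_at t \<omega>)) \<partial>M)"
    using nn_integral_root_lr_Suc[of "\<lambda>_. 1"] by simp
  also have "\<dots> \<le> (\<integral>\<^sup>+ \<omega>. ennreal (root_lr \<gamma> t \<omega>) * (1 * 1) \<partial>M)"
    by (rule nn_integral_mono_AE, use AE_admissible[of t] in eventually_elim)
      (intro mult_left_mono mult_mono; use aff_le_1[OF assms] in auto)
  finally show ?thesis by simp
qed

text \<open>
  One step need not contract: the affinity may be arbitrarily close to 1 at some states. But since
  \<open>sdens\<close> is bounded below, the next state lies in the set of distinguishing states with
  probability bounded away from 0, whatever the current state, so two steps do contract.
\<close>

lemma nn_integral_root_lr_contraction: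
  assumes \<gamma>: "\<gamma> \<in> params m" "\<gamma> \<noteq> \<theta>" and sep: "entropy_separated m \<theta>" and x0: "x0 \<in> states m"
  obtains \<rho> :: real where "0 \<le> \<rho>" "\<rho> < 1"
    "\<And>t. (\<integral>\<^sup>+ \<omega>. ennreal (root_lr \<gamma> (Suc (Suc t)) \<omega>) \<partial>M) \<le> ennreal \<rho> * (\<integral>\<^sup>+ \<omega>. ennreal (root_lr \<gamma> t \<omega>) \<partial>M)"
proof -
  obtain A \<kappa> where A[measurable]: "A \<in> sets \<S>" and Apos: "emeasure (st_base m) A > 0" and \<kappa>: "0 < \<kappa>" "\<kappa> \<le> 1"
    and A_le: "\<And>x \<delta>. x \<in> A \<Longrightarrow> \<delta> \<in> params m \<Longrightarrow> raff \<gamma> x (\<mu> \<delta> x) * saff \<gamma> (\<lambda>_. 1) x (\<mu> \<delta> x) \<le> ennreal (1 - \<kappa>)"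
    using distinguishing_states[OF assms] by metis
  obtain c1 where c1: "0 < c1" "\<And>x u y. (x, u) \<in> graph m \<Longrightarrow> y \<in> states m \<Longrightarrow> c1 \<le> sdens \<theta> y x u"
    using dens_lower_bound[OF true_param] by metis
  obtain c2 where c2: "0 < c2" "\<And>x u y. (x, u) \<in> graph m \<Longrightarrow> y \<in> states m \<Longrightarrow> c2 \<le> sdens \<gamma> y x u"
    using dens_lower_bound[OF \<gamma>(1)] by metis
  \<comment> \<open>\<open>g\<close> dominates the affinity at a state under every policy in the
    family, and it is a function of the state alone; hence it can serve as the weight in the
    recursion.\<close>
  define g where "g x = (if x \<in> A then ennreal (1 - \<kappa>) else 1)" for x
  have [measurable]: "g \<in> borel_measurable \<S>" unfolding g_def[abs_def] by measurable
  \<comment> \<open>The loss gained from visiting \<open>A\<close>: there the weight removes the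
    fraction \<open>\<kappa>\<close> of an integrand that is at least \<open>sqrt (c1 * c2)\<close>.
    Neither bound depends on the current state and control.\<close>
  define d where "d = ennreal (\<kappa> * sqrt (c1 * c2)) * emeasure (st_base m) A"
  have d_le: "saff \<gamma> g x u + d \<le> 1" if xu: "(x, u) \<in> graph m" for x u
  proof -
    have [simp]: "x \<in> space \<S>" "u \<in> space \<C>" using graph_in_space[OF xu] by auto
    have "d = (\<integral>\<^sup>+ y. ennreal (\<kappa> * sqrt (c1 * c2)) * indicator A y \<partial>st_base m)"
      unfolding d_def by (rule nn_integral_cmult_indicator[symmetric]) measurable
    then have "saff \<gamma> g x u + d = (\<integral>\<^sup>+ y. ennreal (sqrt (sdens \<theta> y x u * sdens \<gamma> y x u)) * g y
        + ennreal (\<kappa> * sqrt (c1 * c2)) * indicator A y \<partial>st_base m)"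
      unfolding saff_def by (subst nn_integral_add) auto
    also have "\<dots> \<le> saff \<gamma> (\<lambda>_. 1) x u"
      unfolding saff_def
    proof (rule nn_integral_mono)
      fix y assume "y \<in> space (st_base m)"
      then have y: "y \<in> states m" by (simp add: space_base)
      let ?s = "sqrt (sdens \<theta> y x u * sdens \<gamma> y x u)"
      have "sqrt (c1 * c2) \<le> ?s"
        using c1(1) c1(2)[OF xu y] c2(1) c2(2)[OF xu y] by (intro real_sqrt_le_mono mult_mono) auto
      then have "?s * (1 - \<kappa>) + \<kappa> * sqrt (c1 * c2) \<le> ?s"
        using mult_left_mono[of "sqrt (c1 * c2)" ?s \<kappa>] \<kappa> by (simp add: algebra_simps)
      moreover have "0 \<le> ?s" using dens_nonneg(2)[OF y] by simp
      ultimately show "ennreal ?s * g y + ennreal (\<kappa> * sqrt (c1 * c2)) * indicator A y \<le> ennreal ?s * 1"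
        using \<kappa> c1(1) c2(1) by (auto simp: g_def split: split_indicator simp flip: ennreal_mult ennreal_plus)
    qed
    also have "\<dots> \<le> 1" by (rule aff_le_1[OF \<gamma>(1) xu])
    finally show ?thesis .
  qed
  \<comment> \<open>The measure of \<open>A\<close> could be infinite a priori. The bound just
    proved, applied at \<open>x0\<close>, shows that \<open>d\<close> is a finite real.\<close>
  have "d \<le> 1"
    using d_le[OF policy_graph[OF true_param x0]] by (metis add.commute le_add_same_cancel1 order_trans zero_le add_increasing2 order_refl)
  moreover have "d > 0"
    using Apos \<kappa> c1(1) c2(1) by (simp add: d_def ennreal_zero_less_mult_iff)
  ultimately obtain d' where d': "d = ennreal d'" "0 < d'" "d' \<le> 1"
    by (cases d) (auto simp: top_unique)
  have saff_g: "saff \<gamma> g x u \<le> ennreal (1 - d')" if "(x, u) \<in> graph m" for x u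
  proof (cases "saff \<gamma> g x u")
    case (real r)
    then have "ennreal (r + d') \<le> ennreal 1" using d_le[OF that] d' by simp
    then show ?thesis using real d' by (subst (asm) ennreal_le_iff) (auto intro: ennreal_leI)
  qed (use d_le[OF that] in \<open>simp add: top_unique\<close>)
  have g_ge: "AE \<omega> in M. raff \<gamma> (X_at t \<omega>) (U_at t \<omega>) * saff \<gamma> (\<lambda>_. 1) (X_at t \<omega>) (U_at t \<omega>) \<le> g (X_at t \<omega>)" for t
    using AE_admissible[of t]
  proof eventually_elim
    case (elim \<omega>)
    then have "raff \<gamma> (X_at t \<omega>) (U_at t \<omega>) * saff \<gamma> (\<lambda>_. 1) (X_at t \<omega>) (U_at t \<omega>) \<le> 1 * 1"
      by (intro mult_mono aff_le_1[OF \<gamma>(1)]) auto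
    then show ?case using elim A_le by (auto simp: g_def)
  qed
  have "(\<integral>\<^sup>+ \<omega>. ennreal (root_lr \<gamma> (Suc (Suc t)) \<omega>) \<partial>M) \<le> ennreal (1 - d') * (\<integral>\<^sup>+ \<omega>. ennreal (root_lr \<gamma> t \<omega>) \<partial>M)" for t
  proof -
    have "(\<integral>\<^sup>+ \<omega>. ennreal (root_lr \<gamma> (Suc (Suc t)) \<omega>) \<partial>M) = (\<integral>\<^sup>+ \<omega>. ennreal (root_lr \<gamma> (Suc t) \<omega>) *
        (raff \<gamma> (X_at (Suc t) \<omega>) (U_at (Suc t) \<omega>) * saff \<gamma> (\<lambda>_. 1) (X_at (Suc t) \<omega>) (U_at (Suc t) \<omega>)) \<partial>M)"
      using nn_integral_root_lr_Suc[of "\<lambda>_. 1"] by simp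
    also have "\<dots> \<le> (\<integral>\<^sup>+ \<omega>. ennreal (root_lr \<gamma> (Suc t) \<omega>) * g (X_at (Suc t) \<omega>) \<partial>M)"
      by (rule nn_integral_mono_AE, use g_ge[of "Suc t"] in eventually_elim) (rule mult_left_mono, auto)
    \<comment> \<open>The recursion is applied a second time, now with weight \<open>g\<close>; the
      uniform gain comes from this step.\<close>
    also have "\<dots> = (\<integral>\<^sup>+ \<omega>. ennreal (root_lr \<gamma> t \<omega>) *
        (raff \<gamma> (X_at t \<omega>) (U_at t \<omega>) * saff \<gamma> g (X_at t \<omega>) (U_at t \<omega>)) \<partial>M)"
      by (rule nn_integral_root_lr_Suc) measurable
    also have "\<dots> \<le> (\<integral>\<^sup>+ \<omega>. ennreal (root_lr \<gamma> t \<omega>) * (1 * ennreal (1 - d')) \<partial>M)"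
      by (rule nn_integral_mono_AE, use AE_admissible[of t] in eventually_elim)
        (intro mult_left_mono mult_mono; use aff_le_1[OF \<gamma>(1)] saff_g in auto)
    also have "\<dots> = ennreal (1 - d') * (\<integral>\<^sup>+ \<omega>. ennreal (root_lr \<gamma> t \<omega>) \<partial>M)"
      by (simp add: nn_integral_cmult mult.commute)
    finally show ?thesis .
  qed
  then show thesis
    using d' by (intro that[of "1 - d'"]) auto
qed

section \<open>Almost sure convergence of the likelihood ratios and of the posterior\<close>

text \<open>The contraction acts over two steps, so even and odd times are treated as separate
  sequences. Along each the expectations decay geometrically from a start of at most 1.\<close>

lemma root_lr_tendsto_0:
  assumes \<gamma>: "\<gamma> \<in> params m" "\<gamma> \<noteq> \<theta>" and "entropy_separated m \<theta>" "x0 \<in> states m"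
  shows "AE \<omega> in M. (\<lambda>t. root_lr \<gamma> t \<omega>) \<longlonglongrightarrow> 0"
proof -
  obtain \<rho> :: real where \<rho>: "0 \<le> \<rho>" "\<rho> < 1"
    and step: "\<And>t. (\<integral>\<^sup>+ \<omega>. ennreal (root_lr \<gamma> (Suc (Suc t)) \<omega>) \<partial>M) \<le> ennreal \<rho> * (\<integral>\<^sup>+ \<omega>. ennreal (root_lr \<gamma> t \<omega>) \<partial>M)"
    using nn_integral_root_lr_contraction[OF assms] by metis
  have init: "(\<integral>\<^sup>+ \<omega>. ennreal (root_lr \<gamma> i \<omega>) \<partial>M) \<le> 1" if "i = 0 \<or> i = 1" for i
  proof -
    have "(\<integral>\<^sup>+ \<omega>. ennreal (root_lr \<gamma> 0 \<omega>) \<partial>M) = 1"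
      by (simp add: root_lr_def M.emeasure_space_1)
    with that nn_integral_root_lr_Suc_le[OF \<gamma>(1), of 0] show ?thesis by auto
  qed
  have lim: "AE \<omega> in M. (\<lambda>n. root_lr \<gamma> (2 * n + i) \<omega>) \<longlonglongrightarrow> 0" if i: "i = 0 \<or> i = 1" for i
  proof -
    have bound: "(\<integral>\<^sup>+ \<omega>. ennreal (root_lr \<gamma> (2 * n + i) \<omega>) \<partial>M) \<le> ennreal (\<rho> ^ n)" for n
    proof (induction n)
      case 0
      then show ?case using init[OF i] by simp
    next
      case (Suc n)
      have "(\<integral>\<^sup>+ \<omega>. ennreal (root_lr \<gamma> (2 * Suc n + i) \<omega>) \<partial>M) \<le> ennreal \<rho> * (\<integral>\<^sup>+ \<omega>. ennreal (root_lr \<gamma> (2 * n + i) \<omega>) \<partial>M)"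
        using step[of "2 * n + i"] by simp
      also have "\<dots> \<le> ennreal \<rho> * ennreal (\<rho> ^ n)"
        by (intro mult_left_mono Suc.IH) simp
      finally show ?case using \<rho> by (simp add: ennreal_mult')
    qed
    \<comment> \<open>\<open>root_lr\<close> is known to be nonnegative only on
      \<open>space M\<close>; the absolute value gives the nonnegativity everywhere that the
      geometric criterion asks for.\<close>
    have "AE \<omega> in M. (\<lambda>n. \<bar>root_lr \<gamma> (2 * n + i) \<omega>\<bar>) \<longlonglongrightarrow> 0"
    proof (rule AE_tendsto_0_of_geometric[OF _ _ _ \<rho>])
      fix n
      have "(\<integral>\<^sup>+ \<omega>. ennreal \<bar>root_lr \<gamma> (2 * n + i) \<omega>\<bar> \<partial>M) = (\<integral>\<^sup>+ \<omega>. ennreal (root_lr \<gamma> (2 * n + i) \<omega>) \<partial>M)"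
        by (intro nn_integral_cong) (simp add: root_lr_nonneg)
      with bound[of n] show "(\<integral>\<^sup>+ \<omega>. ennreal \<bar>root_lr \<gamma> (2 * n + i) \<omega>\<bar> \<partial>M) \<le> ennreal (\<rho> ^ n)" by simp
    qed auto
    then show ?thesis by (simp add: tendsto_rabs_zero_iff)
  qed
  show ?thesis
    using lim[of 0, simplified] lim[of 1, simplified]
    by eventually_elim (rule limseq_even_odd, auto)
qed

text \<open>On an admissible trajectory the extended densities are the given ones and all are
  positive, so the quotient can be formed factor by factor and each square root squares back to its
  ratio.\<close>

lemma likelihood_ratio:
  assumes \<gamma>: "\<gamma> \<in> params m" and \<omega>: "\<omega> \<in> space M" and adm: "\<And>s. (X_at s \<omega>, U_at s \<omega>) \<in> graph m"
  shows "likelihood m \<gamma> t \<omega> / likelihood m \<theta> t \<omega> = (root_lr \<gamma> t \<omega>)\<^sup>2" and "likelihood m \<theta> t \<omega> > 0"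
proof -
  let ?f = "\<lambda>\<gamma> s. rdens \<gamma> (R_at s \<omega>) (X_at s \<omega>) (U_at s \<omega>)"
  let ?q = "\<lambda>\<gamma> s. sdens \<gamma> (X_at (Suc s) \<omega>) (X_at s \<omega>) (U_at s \<omega>)"
  have pos: "?f \<delta> s > 0" "?q \<delta> s > 0" if "\<delta> \<in> params m" for \<delta> s
    using dens_pos[OF that adm[of s]] measurable_space[OF measurable_X_at \<omega>] measurable_space[OF measurable_R_at \<omega>]
    by (simp_all add: space_spaces)
  \<comment> \<open>Shift of the index: the factor for \<open>s\<close> in \<open>1..t\<close>
    becomes the one for \<open>s - 1\<close> below \<open>t\<close>.\<close>
  have L: "likelihood m \<delta> t \<omega> = (\<Prod>s<t. ?f \<delta> s * ?q \<delta> s)" if "\<delta> \<in> params m" for \<delta>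
    unfolding likelihood_def using that adm
    by (intro prod.reindex_bij_witness[of _ Suc "\<lambda>s. s - 1"]) (auto simp: rdens_def sdens_def)
  show "likelihood m \<theta> t \<omega> > 0"
    unfolding L[OF true_param] using pos[OF true_param] by (intro prod_pos) simp
  have "(root_lr \<gamma> t \<omega>)\<^sup>2 = (\<Prod>s<t. (sqrt (?f \<gamma> s / ?f \<theta> s) * sqrt (?q \<gamma> s / ?q \<theta> s))\<^sup>2)"
    by (simp add: root_lr_def prod_power_distrib)
  also have "\<dots> = (\<Prod>s<t. (?f \<gamma> s * ?q \<gamma> s) / (?f \<theta> s * ?q \<theta> s))"
    using pos[OF \<gamma>] pos[OF true_param] by (intro prod.cong) (auto simp: power_mult_distrib less_imp_le)
  finally show "likelihood m \<gamma> t \<omega> / likelihood m \<theta> t \<omega> = (root_lr \<gamma> t \<omega>)\<^sup>2"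
    by (simp add: L \<gamma> true_param prod_dividef)
qed

lemma posterior_tendsto_1:
  assumes x0: "x0 \<in> states m" and prior: "\<And>\<gamma>. \<gamma> \<in> params m \<Longrightarrow> prior \<gamma> > 0" and sep: "entropy_separated m \<theta>"
  shows "AE \<omega> in M. (\<lambda>t. posterior m prior \<theta> t \<omega>) \<longlonglongrightarrow> 1"
proof -
  have fin: "finite (params m)" using family by (simp add: mdp_family_def)
  have "AE \<omega> in M. \<forall>\<gamma>\<in>params m - {\<theta>}. (\<lambda>t. root_lr \<gamma> t \<omega>) \<longlonglongrightarrow> 0"
    using fin by (intro AE_finite_allI) (auto intro: root_lr_tendsto_0 sep x0)
  moreover have "AE \<omega> in M. \<forall>t. (X_at t \<omega>, U_at t \<omega>) \<in> graph m"
    unfolding AE_all_countable using AE_admissible by (auto elim: eventually_mono)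
  ultimately show ?thesis
    using AE_space
  proof eventually_elim
    case (elim \<omega>)
    note lr = likelihood_ratio[OF _ elim(3) elim(2)[rule_format]]
    \<comment> \<open>Numerator and denominator are divided by the positive likelihood of
      \<open>\<theta>\<close>. What remains in the denominator is the prior of
      \<open>\<theta>\<close> plus a finite sum of terms that tend to 0.\<close>
    have post: "posterior m prior \<theta> t \<omega> =
        prior \<theta> / (prior \<theta> + (\<Sum>\<gamma>\<in>params m - {\<theta>}. (root_lr \<gamma> t \<omega>)\<^sup>2 * prior \<gamma>))" for t
    proof -
      have pos: "likelihood m \<theta> t \<omega> > 0" by (rule lr(2)[OF true_param])
      have "(\<Sum>\<gamma>\<in>params m. likelihood m \<gamma> t \<omega> * prior \<gamma>) =
          likelihood m \<theta> t \<omega> * prior \<theta> + (\<Sum>\<gamma>\<in>params m - {\<theta>}. likelihood m \<gamma> t \<omega> * prior \<gamma>)"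
        by (rule sum.remove[OF fin true_param])
      also have "(\<Sum>\<gamma>\<in>params m - {\<theta>}. likelihood m \<gamma> t \<omega> * prior \<gamma>) =
          likelihood m \<theta> t \<omega> * (\<Sum>\<gamma>\<in>params m - {\<theta>}. (root_lr \<gamma> t \<omega>)\<^sup>2 * prior \<gamma>)"
        unfolding sum_distrib_left
        using pos by (intro sum.cong refl) (simp add: lr(1)[symmetric])
      finally show ?thesis
        unfolding posterior_def using pos by (simp add: distrib_left[symmetric])
    qed
    have "(\<lambda>t. \<Sum>\<gamma>\<in>params m - {\<theta>}. (root_lr \<gamma> t \<omega>)\<^sup>2 * prior \<gamma>) \<longlonglongrightarrow> (\<Sum>\<gamma>\<in>params m - {\<theta>}. 0\<^sup>2 * prior \<gamma>)"
      using elim(1) by (intro tendsto_intros) auto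
    then have "(\<lambda>t. posterior m prior \<theta> t \<omega>) \<longlonglongrightarrow> prior \<theta> / (prior \<theta> + (\<Sum>\<gamma>\<in>params m - {\<theta>}. 0\<^sup>2 * prior \<gamma>))"
      unfolding post using prior[OF true_param] by (intro tendsto_divide tendsto_add tendsto_const) auto
    then show ?case using prior[OF true_param] by simp
  qed
qed

end

theorem theorem1:
  fixes m :: "('x::polish_space, 'u::polish_space, 'p) mdp"
    and \<mu> :: "'p \<Rightarrow> 'x \<Rightarrow> 'u"
    and prior :: "'p \<Rightarrow> real"
    and \<theta> :: 'p
    and x0 :: 'x
    and M :: "('x, 'p, 'u) traj measure"
  assumes "mdp_family m"
    and "\<theta> \<in> params m"
    and "x0 \<in> states m"
    and "optimal_policies m \<mu>"
    and "\<forall>\<gamma>\<in>params m. prior \<gamma> > 0"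
    and "(\<Sum>\<gamma>\<in>params m. prior \<gamma>) = 1"
    and "thompson_law m \<mu> prior \<theta> x0 M"
    and "densities_bounded_below m"
    and "entropy_separated m \<theta>"
    and "AE \<omega> in M. convergent (\<lambda>t. posterior m prior \<theta> t \<omega>)"
  shows "AE \<omega> in M. (\<lambda>t. posterior m prior \<theta> t \<omega>) \<longlonglongrightarrow> 1"
proof -
  interpret thompson_sampling m \<mu> prior \<theta> x0 M
    by unfold_locales fact+
  show ?thesis
    using assms by (intro posterior_tendsto_1) auto
qed

end
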